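(* Let $\alpha\in(0,1)$ be irrational, $d\ge1$, $\beta_1,\dots,\beta_d\in[0,1)$, and $\psi(x)=\{x\}-\frac12$. Over the rotation $Tx=x+\alpha$ of $\mathbb T$, the cocycle $\Psi_{d+1}(x)=(\psi(x),\psi(x+\beta_1),\dots,\psi(x+\beta_d))$ with values in $\mathbb R^{d+1}$ is regular if and only if the step cocycle $\Phi_d(x)=\bigl(1_{[0,1-\beta_j)}(x)-1+\beta_j\bigr)_{j=1,\dots,d}$ with values in $\mathbb R^d$ is regular.
   Context: $\mathbb T=[0,1)$ is the additive circle (addition mod $1$) with Lebesgue measure $\mu$; $\{x\}$ is the fractional part. A measurable function $\Phi:\mathbb T\to\mathbb R^m$ is called a cocycle over $T$. Two cocycles $\Phi,\Psi:\mathbb T\to\mathbb R^m$ are cohomologous if $\Phi-\Psi=f-f\circ T$ a.e. for some measurable $f:\mathbb T\to\mathbb R^m$. A cocycle $\Phi:\mathbb T\to\mathbb R^m$ is regular if it is cohomologous to a cocycle $\Psi$ taking values in a closed subgroup $H\subset\mathbb R^m$ such that $T_\Psi(x,h)=(Tx,h+\Psi(x))$ is ergodic on $\mathbb T\times H$ for the product of $\mu$ and Haar measure on $H$. *)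

theory Defs
  imports "HOL-Analysis.Analysis"
begin

text \<open>
  The circle is the interval \<open>[0,1)\<close> with addition modulo 1. A function on the circle is a function
  on \<open>real\<close> of which only the values on \<open>[0,1)\<close> matter.
\<close>

definition circle :: "real measure" where
  "circle = restrict_space lborel {0..<1}"

definition rotation :: "real \<Rightarrow> real \<Rightarrow> real" where
  "rotation \<alpha> x = frac (x + \<alpha>)"

definition cocycle :: "(real \<Rightarrow> 'a::euclidean_space) \<Rightarrow> bool" where
  "cocycle \<Phi> \<longleftrightarrow> \<Phi> \<in> borel_measurable circle"

definition cohomologous ::
    "(real \<Rightarrow> real) \<Rightarrow> (real \<Rightarrow> 'a::euclidean_space) \<Rightarrow> (real \<Rightarrow> 'a) \<Rightarrow> bool" where
  "cohomologous T \<Phi> \<Psi> \<longleftrightarrow>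
     (\<exists>f \<in> borel_measurable circle. AE x in circle. \<Phi> x - \<Psi> x = f x - f (T x))"

definition closed_subgroup :: "'a::euclidean_space set \<Rightarrow> bool" where
  "closed_subgroup H \<longleftrightarrow> closed H \<and> 0 \<in> H \<and> (\<forall>x\<in>H. \<forall>y\<in>H. x + y \<in> H) \<and> (\<forall>x\<in>H. - x \<in> H)"

text \<open>
  A Haar measure on a closed subgroup \<open>H\<close> of a Euclidean space: a nonzero translation-invariant
  Borel measure on \<open>H\<close> that is finite on compact sets. Regularity of the measure is automatic,
  since \<open>H\<close> is locally compact and second countable.
\<close>

definition haar_measure_on :: "'a::euclidean_space set \<Rightarrow> 'a measure \<Rightarrow> bool" where
  "haar_measure_on H \<eta> \<longleftrightarrow>
     sets \<eta> = sets (restrict_space borel H) \<and>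
     emeasure \<eta> H \<noteq> 0 \<and>
     (\<forall>K. compact K \<and> K \<subseteq> H \<longrightarrow> emeasure \<eta> K < \<infinity>) \<and>
     (\<forall>h\<in>H. \<forall>B\<in>sets \<eta>. emeasure \<eta> ((\<lambda>x. h + x) ` B) = emeasure \<eta> B)"

definition ergodic :: "'b measure \<Rightarrow> ('b \<Rightarrow> 'b) \<Rightarrow> bool" where
  "ergodic M S \<longleftrightarrow>
     S \<in> measurable M M \<and> distr M M S = M \<and>
     (\<forall>A\<in>sets M. S -` A \<inter> space M = A \<longrightarrow>
        emeasure M A = 0 \<or> emeasure M (space M - A) = 0)"

definition skew_product ::
    "(real \<Rightarrow> real) \<Rightarrow> (real \<Rightarrow> 'a::euclidean_space) \<Rightarrow> real \<times> 'a \<Rightarrow> real \<times> 'a" where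
  "skew_product T \<Psi> = (\<lambda>(x, h). (T x, h + \<Psi> x))"

text \<open>
  As a Haar measure exists and is unique up to a positive factor, the quantification over
  \<open>\<eta>\<close> below just names the Haar measure of \<open>H\<close>.
\<close>

definition regular_cocycle :: "(real \<Rightarrow> real) \<Rightarrow> (real \<Rightarrow> 'a::euclidean_space) \<Rightarrow> bool" where
  "regular_cocycle T \<Phi> \<longleftrightarrow> cocycle \<Phi> \<and>
     (\<exists>\<Psi> H \<eta>. cocycle \<Psi> \<and> cohomologous T \<Phi> \<Psi> \<and>
        closed_subgroup H \<and> (\<forall>x\<in>{0..<1}. \<Psi> x \<in> H) \<and>
        haar_measure_on H \<eta> \<and> ergodic (circle \<Otimes>\<^sub>M \<eta>) (skew_product T \<Psi>))"

definition sawtooth :: "real \<Rightarrow> real" where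
  "sawtooth x = frac x - 1/2"

text \<open>
  With \<open>d = CARD('d)\<close>, the space of \<open>(d + 1)\<close>-tuples is rendered as the Euclidean space
  \<open>real \<times> (real ^ 'd)\<close>, whose first component is the unshifted coordinate.
\<close>

definition sawtooth_cocycle :: "real ^ 'd \<Rightarrow> real \<Rightarrow> real \<times> (real ^ 'd)" where
  "sawtooth_cocycle \<beta> x = (sawtooth x, \<chi> j. sawtooth (x + \<beta> $ j))"

definition step_cocycle :: "real ^ 'd \<Rightarrow> real \<Rightarrow> real ^ 'd" where
  "step_cocycle \<beta> x = (\<chi> j. indicator {0..<1 - \<beta> $ j} x - 1 + \<beta> $ j)"

end

theory Submission imports Defs begin

text \<open>
  Since \<open>\<psi>(x + \<beta>\<^sub>j) - \<psi>(x) = 1\<^bsub>[0,1-\<beta>\<^sub>j)\<^esub>(x) - 1 + \<beta>\<^sub>j\<close>, the cocycle \<open>\<Psi>\<^bsub>d+1\<^esub>\<close> is, up to a linear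
  change of coordinates, the pair \<open>(\<psi>, \<Phi>\<^sub>d)\<close>. The main point is that every set that is invariant under its
  skew product on \<open>[0,1) \<times> \<real>\<^bsup>d+1\<^esup>\<close> is invariant under the translations by \<open>(t, \<dots>, t)\<close>. Along
  the denominators \<open>q\<close> of the convergents of \<open>\<alpha>\<close> the sums of \<open>\<psi>\<close> are bounded, and the \<open>q\<close>-th sum
  of \<open>\<Psi>\<^bsub>d+1\<^esub>\<close> grows by exactly \<open>(t, \<dots>, t)\<close> from \<open>x\<close> to \<open>x + t/q\<close>, unless a jump occurs in between, which
  concerns a set of \<open>x\<close> of measure at most \<open>(d+1) t\<close>. As \<open>q\<close> tends to infinity, continuity of translations
  in measure shows that the set of \<open>x\<close> over which invariance under \<open>(t, \<dots>, t)\<close> fails has measure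
  at most \<open>(d+1) t\<close>. It is contained in the corresponding set for \<open>t/m\<close>, hence it is null.

  Consequently a closed subgroup in which a cocycle cohomologous to \<open>\<Psi>\<^bsub>d+1\<^esub>\<close> takes its values contains the
  diagonal, so ergodicity passes to the quotient by the diagonal, and conversely an invariant set of the
  extension of an ergodic skew product by \<open>\<psi>\<close> comes from an invariant set of that skew product.
\<close>

section \<open>Measure-preserving skew products over a rotation\<close>

text \<open>The bound on the sawtooth sums makes the limit possible: translation is continuous in
  measure only on bounded pieces of a set, so all fibre points that are compared must stay in a ball
  whose radius is fixed before q is chosen. The comparison is a conjugation: the fibre translation
  by (t, ..., t) over x + q\<alpha> is the same as going back q steps, moving the base by t/q, going
  forward q steps and moving the base back, and only the two base moves can break invariance.

  In the converse direction the obstacle is that the values lie in an arbitrary closed subgroup H,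
  while the invariance principle concerns subsets of [0,1) x R^(d+1) and Lebesgue measure. A set
  over H is therefore pulled back by a Borel map p from R^d to H with p(z + h) = p(z) + h. The image
  of Lebesgue measure under p need not be the Haar measure; the return to H is made by proving the
  statement for every translate p(z) + h and letting Fubini trade almost every z for almost every
  h.\<close>

lemma space_circle [simp]: "space circle = {0..<1}"
  by (simp add: circle_def space_restrict_space)

lemma sets_circle: "sets circle = sets (restrict_space borel {0..<1})"
  by (simp add: circle_def sets_restrict_space)

lemma sets_circle_iff: "A \<in> sets circle \<longleftrightarrow> A \<in> sets borel \<and> A \<subseteq> {0..<1}"
  by (auto simp: circle_def sets_restrict_space_iff)

lemma emeasure_circle: "A \<subseteq> {0..<1} \<Longrightarrow> emeasure circle A = emeasure lborel A"
  unfolding circle_def by (rule emeasure_restrict_space) auto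

lemma emeasure_space_circle: "emeasure circle (space circle) = 1"
  by (simp add: emeasure_circle)

interpretation circle: finite_measure circle
  by standard (use emeasure_space_circle in simp)

lemma measurable_circle_restrict:
  "f \<in> borel_measurable borel \<Longrightarrow> f \<in> borel_measurable circle"
  by (simp add: circle_def measurable_restrict_space1)

lemma measurable_id_circle: "(\<lambda>x. x) \<in> borel_measurable circle"
  by (rule measurable_circle_restrict) simp

lemma frac_measurable [measurable]: "frac \<in> borel_measurable (borel :: real measure)"
  unfolding frac_def[abs_def] by measurable

lemma measurable_into_circle:
  assumes "f \<in> borel_measurable M" "\<And>x. x \<in> space M \<Longrightarrow> f x \<in> {0..<1}"
  shows "f \<in> measurable M circle"
  unfolding measurable_cong_sets[OF refl sets_circle]
  using assms by (intro measurable_restrict_space2) auto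

lemma measurable_frac_circle [measurable (raw)]:
  assumes "f \<in> borel_measurable M"
  shows "(\<lambda>x. frac (f x :: real)) \<in> measurable M circle"
  using assms by (intro measurable_into_circle) (auto simp: frac_lt_1)

lemma measurable_rotation [measurable]: "rotation c \<in> measurable circle circle"
  unfolding rotation_def[abs_def]
  by (intro measurable_frac_circle borel_measurable_add measurable_id_circle) simp

lemma rotation_bounds [simp]: "0 \<le> rotation c x" "rotation c x < 1"
  by (simp_all add: rotation_def frac_lt_1)

lemma rotation_mem [simp]: "rotation c x \<in> {0..<1}"
  by simp

lemma distr_rotation: "distr circle circle (rotation c) = circle"
proof (rule measure_eqI)
  fix A assume "A \<in> sets (distr circle circle (rotation c))"
  then have A: "A \<in> sets borel" "A \<subseteq> {0..<1}" and Ac: "A \<in> sets circle"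
    by (auto simp: sets_circle_iff)
  define r where "r = frac c"
  have r: "0 \<le> r" "r < 1" by (auto simp: r_def frac_lt_1)
  have rot: "rotation c x = (if x + r < 1 then x + r else x + r - 1)" if "x \<in> {0..<1}" for x
  proof -
    have "rotation c x = frac (x + r)"
      unfolding rotation_def r_def by simp
    also have "\<dots> = (if x + r < 1 then x + r else x + r - 1)"
      using that r by (auto simp: frac_unique_iff)
    finally show ?thesis .
  qed
  \<comment> \<open>Rotation by r is the translation by r onto [r,1) and the translation by r - 1
    onto [0,r), so A is cut at r.\<close>
  let ?A1 = "A \<inter> {r..<1}" and ?A2 = "A \<inter> {0..<r}"
  have [measurable]: "A \<in> sets borel" by fact
  have eq: "rotation c -` A \<inter> {0..<1} = (\<lambda>x. r + x) -` ?A1 \<union> (\<lambda>x. (r - 1) + x) -` ?A2"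
    using A r by (auto simp: rot algebra_simps split: if_splits)
  have "emeasure lborel (rotation c -` A \<inter> {0..<1})
      = emeasure lborel ((\<lambda>x. r + x) -` ?A1) + emeasure lborel ((\<lambda>x. (r - 1) + x) -` ?A2)"
    unfolding eq using r by (intro plus_emeasure[symmetric]) auto
  also have "emeasure lborel ((\<lambda>x. r + x) -` ?A1) = emeasure lborel ?A1"
    using emeasure_distr[of "(+) r" lborel borel ?A1] by (simp add: lborel_distr_plus)
  also have "emeasure lborel ((\<lambda>x. (r - 1) + x) -` ?A2) = emeasure lborel ?A2"
    using emeasure_distr[of "(+) (r - 1)" lborel borel ?A2] by (simp add: lborel_distr_plus)
  also have "emeasure lborel ?A1 + emeasure lborel ?A2 = emeasure lborel (?A1 \<union> ?A2)"
    by (intro plus_emeasure) auto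
  also have "?A1 \<union> ?A2 = A" using A r by auto
  finally show "emeasure (distr circle circle (rotation c)) A = emeasure circle A"
    using A by (simp add: emeasure_distr[OF measurable_rotation Ac] emeasure_circle)
qed simp

section \<open>Haar measures on closed subgroups and skew products with values in them\<close>

lemma haar_sets: "haar_measure_on H \<eta> \<Longrightarrow> sets \<eta> = sets (restrict_space borel H)"
  by (simp add: haar_measure_on_def)

lemma haar_space: "haar_measure_on H \<eta> \<Longrightarrow> space \<eta> = H"
  using sets_eq_imp_space_eq[of \<eta> "restrict_space borel H"]
  by (simp add: haar_measure_on_def space_restrict_space)

lemma haar_sets_iff:
  "closed H \<Longrightarrow> haar_measure_on H \<eta> \<Longrightarrow> A \<in> sets \<eta> \<longleftrightarrow> A \<in> sets borel \<and> A \<subseteq> H"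
  by (auto simp: haar_sets sets_restrict_space_iff borel_closed)

lemma measurable_haar_id:
  "haar_measure_on H \<eta> \<Longrightarrow> (\<lambda>x. x) \<in> borel_measurable \<eta>"
  using measurable_ident_sets measurable_cong_sets haar_sets
  by (metis measurable_id measurable_restrict_space1 eq_id_iff)

lemma measurable_into_haar:
  assumes "haar_measure_on H \<eta>" "f \<in> borel_measurable M" "\<And>x. x \<in> space M \<Longrightarrow> f x \<in> H"
  shows "f \<in> measurable M \<eta>"
  unfolding measurable_cong_sets[OF refl haar_sets[OF assms(1)]]
  using assms(2,3) by (intro measurable_restrict_space2) auto

lemma haar_sigma_finite:
  assumes H: "closed H" and \<eta>: "haar_measure_on H \<eta>"
  shows "sigma_finite_measure \<eta>"
proof
  let ?A = "range (\<lambda>n::nat. H \<inter> cball 0 (real n))"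
  have "\<Union>?A = H"
    using real_arch_simple by (auto simp: dist_norm)
  moreover have "emeasure \<eta> (H \<inter> cball 0 (real n)) \<noteq> \<infinity>" for n
    using \<eta> H closed_Int_compact[OF H compact_cball] unfolding haar_measure_on_def
    by (metis inf_le1 infinity_ennreal_def order_less_irrefl)
  moreover have "?A \<subseteq> sets \<eta>"
    using haar_sets_iff[OF H \<eta>] H by auto
  ultimately show "\<exists>A. countable A \<and> A \<subseteq> sets \<eta> \<and> \<Union> A = space \<eta> \<and> (\<forall>a\<in>A. emeasure \<eta> a \<noteq> \<infinity>)"
    using haar_space[OF \<eta>] by (intro exI[of _ ?A]) auto
qed

lemma haar_vimage_translation:
  assumes H: "closed_subgroup H" and \<eta>: "haar_measure_on H \<eta>" and k: "k \<in> H" and A: "A \<in> sets \<eta>"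
  shows "emeasure \<eta> {h \<in> H. h + k \<in> A} = emeasure \<eta> A"
proof -
  have "(\<lambda>x. - k + x) ` A = {h \<in> H. h + k \<in> A}"
  proof (intro equalityI subsetI)
    fix x assume "x \<in> (\<lambda>x. - k + x) ` A"
    moreover have "A \<subseteq> H" using sets.sets_into_space[OF A] haar_space[OF \<eta>] by simp
    ultimately show "x \<in> {h \<in> H. h + k \<in> A}" using H k
      by (auto simp: closed_subgroup_def) (metis add_uminus_conv_diff subsetD)
  next
    fix x assume "x \<in> {h \<in> H. h + k \<in> A}"
    then show "x \<in> (\<lambda>x. - k + x) ` A" by (intro image_eqI[of _ _ "x + k"]) auto
  qed
  moreover have "emeasure \<eta> ((\<lambda>x. - k + x) ` A) = emeasure \<eta> A"
    using \<eta> H k A unfolding haar_measure_on_def closed_subgroup_def by blast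
  ultimately show ?thesis by simp
qed

lemma closed_subgroupD:
  assumes "closed_subgroup H"
  shows "closed H" "0 \<in> H" "x \<in> H \<Longrightarrow> y \<in> H \<Longrightarrow> x + y \<in> H" "x \<in> H \<Longrightarrow> - x \<in> H"
    "x \<in> H \<Longrightarrow> y \<in> H \<Longrightarrow> x - y \<in> H"
proof -
  show "x - y \<in> H" if "x \<in> H" "y \<in> H"
    using assms that unfolding closed_subgroup_def by (metis diff_conv_add_uminus)
qed (use assms in \<open>auto simp: closed_subgroup_def\<close>)

lemma distr_haar_translation:
  assumes H: "closed_subgroup H" and \<eta>: "haar_measure_on H \<eta>" and k: "k \<in> H"
  shows "(\<lambda>h. h + k) \<in> measurable \<eta> \<eta>" "distr \<eta> \<eta> (\<lambda>h. h + k) = \<eta>"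
proof -
  show m: "(\<lambda>h. h + k) \<in> measurable \<eta> \<eta>"
    using measurable_haar_id[OF \<eta>] closed_subgroupD(3)[OF H _ k]
    by (intro measurable_into_haar[OF \<eta>] borel_measurable_add borel_measurable_const)
      (auto simp: haar_space[OF \<eta>])
  show "distr \<eta> \<eta> (\<lambda>h. h + k) = \<eta>"
  proof (rule measure_eqI)
    fix A assume "A \<in> sets (distr \<eta> \<eta> (\<lambda>h. h + k))"
    then have A: "A \<in> sets \<eta>" by simp
    have "(\<lambda>h. h + k) -` A \<inter> space \<eta> = {h \<in> H. h + k \<in> A}"
      by (auto simp: haar_space[OF \<eta>])
    then show "emeasure (distr \<eta> \<eta> (\<lambda>h. h + k)) A = emeasure \<eta> A"
      using haar_vimage_translation[OF H \<eta> k A] by (simp add: emeasure_distr[OF m A])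
  qed simp
qed

lemma AE_haar_translate:
  assumes "closed_subgroup H" "haar_measure_on H \<eta>" "k \<in> H" and AE: "AE h in \<eta>. P h"
  shows "AE h in \<eta>. P (h + k)"
  using AE_distrD[OF distr_haar_translation(1)[OF assms(1-3)]] AE
  unfolding distr_haar_translation(2)[OF assms(1-3)] by blast

text \<open>Fubini splits the claim: on the fibre over x the map is a translation by an element of
  H, which preserves \<eta>, and in the base it is a rotation.\<close>

lemma skew_product_haar:
  fixes \<Psi> :: "real \<Rightarrow> 'a::euclidean_space"
  assumes H: "closed_subgroup H" and \<eta>: "haar_measure_on H \<eta>"
    and \<Psi>: "cocycle \<Psi>" "\<forall>x\<in>{0..<1}. \<Psi> x \<in> H"
  shows skew_product_measurable:
      "skew_product (rotation c) \<Psi> \<in> measurable (circle \<Otimes>\<^sub>M \<eta>) (circle \<Otimes>\<^sub>M \<eta>)" (is ?meas)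
    and distr_skew_product:
      "distr (circle \<Otimes>\<^sub>M \<eta>) (circle \<Otimes>\<^sub>M \<eta>) (skew_product (rotation c) \<Psi>) = circle \<Otimes>\<^sub>M \<eta>"
proof -
  have cl: "closed H" using H by (simp add: closed_subgroup_def)
  interpret \<eta>: sigma_finite_measure \<eta> by (rule haar_sigma_finite[OF cl \<eta>])
  have [measurable]: "\<Psi> \<in> borel_measurable circle" using \<Psi>(1) by (simp add: cocycle_def)
  have [measurable]: "(\<lambda>x. x) \<in> borel_measurable \<eta>" by (rule measurable_haar_id[OF \<eta>])
  note [simp] = haar_space[OF \<eta>]
  show meas: ?meas
    unfolding skew_product_def case_prod_beta
  proof (rule measurable_Pair)
    show "(\<lambda>x. snd x + \<Psi> (fst x)) \<in> circle \<Otimes>\<^sub>M \<eta> \<rightarrow>\<^sub>M \<eta>"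
    proof (rule measurable_into_haar[OF \<eta>])
      have "snd \<in> borel_measurable (circle \<Otimes>\<^sub>M \<eta>)"
        using measurable_compose[OF measurable_snd measurable_haar_id[OF \<eta>]] .
      then show "(\<lambda>x. snd x + \<Psi> (fst x)) \<in> borel_measurable (circle \<Otimes>\<^sub>M \<eta>)" by measurable
    qed (use \<Psi>(2) H in \<open>auto simp: space_pair_measure closed_subgroup_def\<close>)
  qed measurable
  let ?S = "skew_product (rotation c) \<Psi>"
  show "distr (circle \<Otimes>\<^sub>M \<eta>) (circle \<Otimes>\<^sub>M \<eta>) ?S = circle \<Otimes>\<^sub>M \<eta>"
  proof (rule measure_eqI)
    fix A assume "A \<in> sets (distr (circle \<Otimes>\<^sub>M \<eta>) (circle \<Otimes>\<^sub>M \<eta>) ?S)"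
    then have A [measurable]: "A \<in> sets (circle \<Otimes>\<^sub>M \<eta>)" by simp
    let ?k = "\<lambda>x. emeasure \<eta> (Pair x -` A)"
    have [measurable]: "?k \<in> borel_measurable circle"
      by (rule \<eta>.measurable_emeasure_Pair[OF A])
    have "emeasure (distr (circle \<Otimes>\<^sub>M \<eta>) (circle \<Otimes>\<^sub>M \<eta>) ?S) A
      = emeasure (circle \<Otimes>\<^sub>M \<eta>) (?S -` A \<inter> space (circle \<Otimes>\<^sub>M \<eta>))"
      by (rule emeasure_distr[OF meas A])
    also have "\<dots> = (\<integral>\<^sup>+x. emeasure \<eta> (Pair x -` (?S -` A \<inter> space (circle \<Otimes>\<^sub>M \<eta>))) \<partial>circle)"
      by (rule \<eta>.emeasure_pair_measure_alt[OF measurable_sets[OF meas A]])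
    also have "\<dots> = (\<integral>\<^sup>+x. ?k (rotation c x) \<partial>circle)"
    proof (rule nn_integral_cong)
      fix x assume x: "x \<in> space circle"
      have "Pair x -` (?S -` A \<inter> space (circle \<Otimes>\<^sub>M \<eta>)) = {h \<in> H. h + \<Psi> x \<in> Pair (rotation c x) -` A}"
        using x by (auto simp: skew_product_def space_pair_measure)
      then show "emeasure \<eta> (Pair x -` (?S -` A \<inter> space (circle \<Otimes>\<^sub>M \<eta>))) = ?k (rotation c x)"
        using haar_vimage_translation[OF H \<eta> _ sets_Pair1[OF A]] \<Psi>(2) x by simp
    qed
    also have "\<dots> = (\<integral>\<^sup>+x. ?k x \<partial>distr circle circle (rotation c))"
      by (rule nn_integral_distr[symmetric]) measurable
    also have "\<dots> = emeasure (circle \<Otimes>\<^sub>M \<eta>) A"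
      unfolding distr_rotation by (rule \<eta>.emeasure_pair_measure_alt[OF A, symmetric])
    finally show "emeasure (distr (circle \<Otimes>\<^sub>M \<eta>) (circle \<Otimes>\<^sub>M \<eta>) ?S) A = emeasure (circle \<Otimes>\<^sub>M \<eta>) A" .
  qed simp
qed

lemma haar_lborel: "haar_measure_on UNIV (lborel :: 'a::euclidean_space measure)"
proof -
  have "emeasure lborel ((+) h ` B) = emeasure lborel B" if "B \<in> sets borel" for h :: 'a and B
  proof -
    have "(+) h ` B = (+) (- h) -` B"
      by (force simp: image_iff intro: bexI[of _ "- h + _"])
    then show ?thesis
      using emeasure_distr[of "(+) (- h)" lborel borel B] that by (simp add: lborel_distr_plus)
  qed
  then show ?thesis
    using emeasure_compact_finite by (auto simp: haar_measure_on_def)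
qed

lemma closed_subgroup_UNIV: "closed_subgroup UNIV"
  by (simp add: closed_subgroup_def)

lemma AE_lborel_translate:
  fixes v :: "'a::euclidean_space"
  shows "AE w in lborel. P w \<Longrightarrow> AE w in lborel. P (w + v)"
  by (rule AE_haar_translate[OF closed_subgroup_UNIV haar_lborel UNIV_I])

section \<open>Bounded sums of the sawtooth function\<close>

text \<open>The offset \<theta>/q + \<delta> lies strictly between -1/q and 2/q, so starting from
  k/q it can lead out of [0,1) only if k = 0 or k = q - 1. There the reduction modulo 1 may cost up
  to 1, which the \<open>of_bool\<close> terms pay for.\<close>

lemma frac_near_grid_point:
  fixes q k :: nat and \<theta> \<delta> :: real
  assumes k: "k < q" and \<theta>: "0 \<le> \<theta>" "\<theta> < 1" and \<delta>: "\<bar>\<delta>\<bar> < 1 / q"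
  shows "\<bar>frac ((k + \<theta>) / q + \<delta>) - k / q\<bar> \<le> 2 / q + of_bool (k = 0) + of_bool (k = q - 1)"
proof (cases "k = 0 \<or> k = q - 1")
  case True
  have "0 \<le> k / q" "k / q < 1" "0 \<le> 2 / real q"
    using k by auto
  moreover have "0 \<le> frac ((k + \<theta>) / q + \<delta>)" "frac ((k + \<theta>) / q + \<delta>) < 1"
    by (auto simp: frac_lt_1)
  ultimately have "\<bar>frac ((k + \<theta>) / q + \<delta>) - k / q\<bar> \<le> 2 / q + 1" by linarith
  also have "\<dots> \<le> 2 / q + of_bool (k = 0) + of_bool (k = q - 1)"
    using True by (elim disjE) auto
  finally show ?thesis .
next
  case False
  have q: "0 < real q" using k by simp
  define u where "u = (k + \<theta>) / q + \<delta>"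
  have eq: "u = k / q + (\<theta> / q + \<delta>)" by (simp add: u_def add_divide_distrib)
  have t: "0 \<le> \<theta> / q" "\<theta> / q < 1 / q" using \<theta> q by (auto simp: divide_strict_right_mono)
  have "1 \<le> k" "k + 2 \<le> q" using False k by auto
  then have "1 / q \<le> k / q" "(real k + 2) / q \<le> 1"
    using q by (auto simp: divide_right_mono)
  then have "1 / q \<le> k / q" "k / q + 2 / q \<le> 1" by (auto simp: add_divide_distrib)
  then have "0 \<le> u" "u < 1"
    using \<delta> t unfolding eq abs_less_iff by (auto simp: divide_simps)
  then have "frac u = u" by (simp add: frac_eq)
  then have "\<bar>frac u - k / q\<bar> \<le> 2 / q"
    using \<delta> t unfolding eq by (auto simp: abs_le_iff abs_less_iff)
  then show ?thesis using False unfolding u_def by (auto intro: order_trans)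
qed

lemma bij_betw_affine_mod:
  fixes m p :: int and q :: nat
  assumes "0 < q" "coprime p (int q)"
  shows "bij_betw (\<lambda>j. nat ((m + int j * p) mod int q)) {..<q} {..<q}"
proof -
  have "inj_on (\<lambda>j. nat ((m + int j * p) mod int q)) {..<q}"
  proof (rule inj_onI)
    fix i j assume ij: "i \<in> {..<q}" "j \<in> {..<q}"
      and eq: "nat ((m + int i * p) mod int q) = nat ((m + int j * p) mod int q)"
    then have "(m + int i * p) mod int q = (m + int j * p) mod int q"
      using assms(1) by (simp add: nat_eq_iff)
    then have "int q dvd (int i - int j) * p"
      by (simp add: mod_eq_dvd_iff algebra_simps)
    then have "int q dvd int i - int j"
      using assms(2) by (simp add: coprime_dvd_mult_left_iff coprime_commute)
    moreover have "\<bar>int i - int j\<bar> < int q" using ij by auto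
    ultimately show "i = j"
      using zdvd_not_zless[of "\<bar>int i - int j\<bar>" "int q"] by fastforce
  qed
  moreover have "(\<lambda>j. nat ((m + int j * p) mod int q)) ` {..<q} \<subseteq> {..<q}"
    using assms(1) by (auto simp: nat_less_iff)
  ultimately show ?thesis
    by (simp add: bij_betw_def endo_inj_surj)
qed

text \<open>The points \<open>x + j p / q\<close> meet each of the \<open>q\<close> arcs of length \<open>1/q\<close> once, and
  \<open>x + j \<alpha>\<close> is within \<open>1/q\<close> of \<open>x + j p / q\<close>.\<close>

lemma denjoy_koksma_sawtooth:
  fixes \<alpha> x :: real and q :: nat and p :: int
  assumes q: "0 < q" and cop: "coprime p (int q)" and ap: "\<bar>\<alpha> - p / q\<bar> < 1 / (real q)\<^sup>2"
  shows "\<bar>\<Sum>j<q. sawtooth (x + real j * \<alpha>)\<bar> \<le> 5"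
proof -
  define m \<theta> where "m = \<lfloor>real q * x\<rfloor>" and "\<theta> = frac (real q * x)"
  define k where "k j = nat ((m + int j * p) mod int q)" for j
  define \<delta> where "\<delta> j = real j * (\<alpha> - p / q)" for j :: nat
  have bij: "bij_betw k {..<q} {..<q}"
    unfolding k_def by (rule bij_betw_affine_mod[OF q cop])
  have near: "\<bar>frac (x + real j * \<alpha>) - k j / q\<bar> \<le> 2 / q + of_bool (k j = 0) + of_bool (k j = q - 1)"
    if j: "j < q" for j
  proof -
    have "\<bar>\<delta> j\<bar> < 1 / q"
    proof (cases "j = 0")
      case False
      have "\<bar>\<delta> j\<bar> = real j * \<bar>\<alpha> - p / q\<bar>" by (simp add: \<delta>_def abs_mult)
      also have "\<dots> < real j * (1 / (real q)\<^sup>2)"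
        by (rule mult_strict_left_mono[OF ap]) (use False in simp)
      also have "\<dots> \<le> real q * (1 / (real q)\<^sup>2)" using j by (intro mult_right_mono) auto
      finally show ?thesis using q by (simp add: power2_eq_square)
    qed (use q in \<open>simp add: \<delta>_def\<close>)
    moreover have "frac (x + real j * \<alpha>) = frac ((k j + \<theta>) / q + \<delta> j)"
    proof -
      define l where "l = (m + int j * p) div int q"
      have "real q * x = m + \<theta>" by (simp add: m_def \<theta>_def frac_def)
      moreover have "m + int j * p = int (k j) + int q * l"
        using q by (simp add: k_def l_def)
      then have "real_of_int m + real j * p = real (k j) + real q * l"
        by (metis of_int_add of_int_mult of_int_of_nat_eq)
      ultimately have "real q * (x + real j * p / q) = real q * ((k j + \<theta>) / q + l)"
        using q by (simp add: field_simps)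
      then have "x + real j * p / q = (k j + \<theta>) / q + l"
        using q by simp
      then have "x + real j * \<alpha> = ((k j + \<theta>) / q + \<delta> j) + of_int l"
        by (simp add: \<delta>_def algebra_simps)
      then show ?thesis by (metis frac_add_of_int_right)
    qed
    ultimately show ?thesis
      using frac_near_grid_point[of "k j" q \<theta> "\<delta> j"] j q
      by (simp add: \<theta>_def frac_lt_1 k_def nat_less_iff)
  qed
  have sum_k: "(\<Sum>j<q. g (k j)) = (\<Sum>i<q. g i)" for g :: "nat \<Rightarrow> real"
    by (rule sum.reindex_bij_betw[OF bij])
  have "\<bar>\<Sum>j<q. frac (x + real j * \<alpha>) - k j / q\<bar>
      \<le> (\<Sum>j<q. 2 / q + of_bool (k j = 0) + of_bool (k j = q - 1))"
    by (rule order_trans[OF sum_abs sum_mono]) (use near in auto)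
  also have "\<dots> = (\<Sum>i<q. 2 / q + of_bool (i = 0) + of_bool (i = q - 1))"
    by (rule sum_k)
  \<comment> \<open>The q terms 2/q give 2, and each of the two indicator terms is 1 for exactly one
    index.\<close>
  also have "\<dots> = 4"
    using q by (simp add: sum.distrib of_bool_def sum.delta)
  finally have 1: "\<bar>(\<Sum>j<q. frac (x + real j * \<alpha>)) - (\<Sum>i<q. i / q)\<bar> \<le> 4"
    using sum_k[of "\<lambda>i. i / q"] by (simp add: sum_subtractf)
  \<comment> \<open>This falls short of q/2 by 1/2, so the sawtooth sum is at most 4 + 1/2 in
    absolute value; 5 is a rounded bound.\<close>
  have "(\<Sum>i<q. i / q) = (real q - 1) / 2"
  proof -
    have "2 * (\<Sum>i<q. real i) = real q * (real q - 1)"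
      by (induction q) (auto simp: algebra_simps)
    then show ?thesis using q by (simp add: sum_divide_distrib[symmetric] field_simps)
  qed
  moreover have "(\<Sum>j<q. sawtooth (x + real j * \<alpha>)) = (\<Sum>j<q. frac (x + real j * \<alpha>)) - real q / 2"
    by (simp add: sawtooth_def sum_subtractf)
  ultimately show ?thesis using 1 by (simp add: abs_le_iff)
qed

text \<open>For irrational \<alpha> Dirichlet's theorem gives infinitely many reduced fractions h/k
  with error below 1/k^2, the elements of \<open>approx_set \<alpha>\<close>. Their denominators are
  unbounded, which makes the set of good q infinite.\<close>

lemma bounded_sawtooth_sums:
  fixes \<alpha> :: real
  assumes "\<alpha> \<notin> \<rat>"
  obtains q :: "nat \<Rightarrow> nat" where "strict_mono q" "\<And>n. 0 < q n"
    "\<And>n x. \<bar>\<Sum>j<q n. sawtooth (x + real j * \<alpha>)\<bar> \<le> 5"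
proof -
  let ?Q = "{q. 0 < q \<and> (\<forall>x. \<bar>\<Sum>j<q. sawtooth (x + real j * \<alpha>)\<bar> \<le> 5)}"
  have "\<exists>q\<in>?Q. N < q" for N :: nat
  proof -
    have "infinite (approx_set \<alpha>)"
      using assms rational_iff_finite_approx_set by blast
    from infinite_approx_set[OF this, of "int N"]
    obtain h k where hk: "(h, k) \<in> approx_set \<alpha>" "int N < k" by blast
    then have "0 < k" "coprime h k" "\<bar>\<alpha> - h / k\<bar> < 1 / (real_of_int k)\<^sup>2"
      by (auto simp: approx_set_def)
    with hk(2) denjoy_koksma_sawtooth[of "nat k" h \<alpha>] show ?thesis
      by (intro bexI[of _ "nat k"]) auto
  qed
  then have "infinite ?Q"
    unfolding infinite_nat_iff_unbounded by blast
  then obtain q :: "nat \<Rightarrow> nat" where "strict_mono q" "\<And>n. q n \<in> ?Q"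
    using infinite_enumerate by blast
  then show ?thesis by (intro that[of q]) auto
qed

section \<open>Birkhoff sums of the sawtooth cocycle\<close>

definition diag :: "real \<Rightarrow> real \<times> (real ^ 'd)" where
  "diag t = (t, vec t)"

lemma diag_add: "diag (s + t) = diag s + diag t"
  by (simp add: diag_def vec_add)

lemma diag_0 [simp]: "diag 0 = 0"
  by (simp add: diag_def zero_prod_def)

lemma diag_minus: "diag (- t) = - diag t"
  by (simp add: diag_def vec_neg)

lemma borel_measurable_vecI:
  fixes f :: "'b \<Rightarrow> real ^ 'd"
  assumes "\<And>j. (\<lambda>x. f x $ j) \<in> borel_measurable M"
  shows "f \<in> borel_measurable M"
  using assms
  by (subst borel_measurable_euclidean_space) (auto simp: Basis_vec_def inner_axis)

lemma measurable_sawtooth [measurable]: "sawtooth \<in> borel_measurable borel"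
  unfolding sawtooth_def[abs_def] by measurable

lemma measurable_vec [measurable]: "(vec :: real \<Rightarrow> real ^ 'd) \<in> borel_measurable borel"
  by (rule borel_measurable_vecI) simp

lemma continuous_on_vec: "continuous_on S (vec :: real \<Rightarrow> real ^ 'd)"
  unfolding vec_def by (intro continuous_intros)

lemma measurable_sawtooth_cocycle [measurable]:
  "sawtooth_cocycle \<beta> \<in> borel_measurable borel"
proof -
  have "(\<lambda>x. \<chi> j. sawtooth (x + \<beta> $ j)) \<in> borel_measurable borel"
    by (rule borel_measurable_vecI) simp
  then show ?thesis unfolding sawtooth_cocycle_def[abs_def] by measurable
qed

lemma measurable_step_cocycle: "step_cocycle \<beta> \<in> borel_measurable borel"
  unfolding step_cocycle_def[abs_def] by (rule borel_measurable_vecI) simp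

lemma sawtooth_cocycle_eq:
  assumes \<beta>: "\<And>j. 0 \<le> \<beta> $ j \<and> \<beta> $ j < 1" and x: "x \<in> {0..<1}"
  shows "sawtooth_cocycle \<beta> x = (0, step_cocycle \<beta> x) + diag (sawtooth x)"
proof -
  have "sawtooth (x + \<beta> $ j) = indicator {0..<1 - \<beta> $ j} x - 1 + \<beta> $ j + sawtooth x" for j
  proof -
    have "frac (x + \<beta> $ j) = (if x + \<beta> $ j < 1 then x + \<beta> $ j else x + \<beta> $ j - 1)"
      using \<beta>[of j] x by (auto simp: frac_unique_iff)
    then show ?thesis using x by (auto simp: sawtooth_def indicator_def)
  qed
  then show ?thesis
    by (simp add: sawtooth_cocycle_def step_cocycle_def diag_def vec_eq_iff)
qed

lemma sawtooth_cocycle_frac: "sawtooth_cocycle \<beta> (frac x) = sawtooth_cocycle \<beta> x"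
  by (simp add: sawtooth_cocycle_def sawtooth_def)

text \<open>The points are not reduced modulo 1. For a 1-periodic function such as the sawtooth
  cocycle this is still the sum along the orbit of the rotation, and x + s can be compared with x on
  the line.\<close>

definition birkhoff_sum :: "real \<Rightarrow> (real \<Rightarrow> 'a::ab_group_add) \<Rightarrow> nat \<Rightarrow> real \<Rightarrow> 'a" where
  "birkhoff_sum \<alpha> \<phi> n x = (\<Sum>j<n. \<phi> (x + real j * \<alpha>))"

lemma sawtooth_sum_frac:
  "birkhoff_sum \<alpha> (sawtooth_cocycle \<beta>) n (frac x) = birkhoff_sum \<alpha> (sawtooth_cocycle \<beta>) n x"
  unfolding birkhoff_sum_def
  by (subst (1 2) sawtooth_cocycle_frac[symmetric]) simp

lemma measurable_birkhoff_sum [measurable]: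
  fixes \<phi> :: "real \<Rightarrow> 'a::euclidean_space"
  assumes [measurable]: "\<phi> \<in> borel_measurable borel"
  shows "birkhoff_sum \<alpha> \<phi> n \<in> borel_measurable borel"
  unfolding birkhoff_sum_def[abs_def] by measurable

lemma fst_sum: "fst (\<Sum>j\<in>I. f j) = (\<Sum>j\<in>I. fst (f j))"
  by (induction I rule: infinite_finite_induct) auto

lemma snd_sum: "snd (\<Sum>j\<in>I. f j) = (\<Sum>j\<in>I. snd (f j))"
  by (induction I rule: infinite_finite_induct) auto

text \<open>The bound on the sawtooth sums is uniform in the starting point, so it also applies at
  each \<open>x + \<beta> $ j\<close>; the d + 1 coordinates are then added up.\<close>

lemma norm_sawtooth_sum_le:
  fixes \<beta> :: "real ^ 'd"
  assumes "\<And>y. \<bar>\<Sum>j<n. sawtooth (y + real j * \<alpha>)\<bar> \<le> C"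
  shows "norm (birkhoff_sum \<alpha> (sawtooth_cocycle \<beta>) n x) \<le> C * (1 + CARD('d))"
proof -
  let ?v = "birkhoff_sum \<alpha> (sawtooth_cocycle \<beta>) n x"
  have "norm ?v \<le> norm (fst ?v) + norm (snd ?v)"
    by (metis norm_Pair_le prod.collapse)
  also have "norm (fst ?v) \<le> C"
    using assms[of x] by (simp add: birkhoff_sum_def fst_sum sawtooth_cocycle_def)
  also have "norm (snd ?v) \<le> (\<Sum>i\<in>UNIV. \<bar>snd ?v $ i\<bar>)"
    by (rule norm_le_l1_cart)
  also have "\<dots> \<le> (\<Sum>i\<in>(UNIV::'d set). C)"
  proof (rule sum_mono)
    fix i
    show "\<bar>snd ?v $ i\<bar> \<le> C"
      using assms[of "x + \<beta> $ i"]
      by (simp add: birkhoff_sum_def snd_sum sawtooth_cocycle_def add_ac)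
  qed
  finally show ?thesis by (simp add: algebra_simps)
qed

text \<open>The points of the circle within \<open>s\<close> to the left of a discontinuity of the \<open>n\<close>-th sum.\<close>

definition jump_set :: "real \<Rightarrow> real ^ 'd \<Rightarrow> nat \<Rightarrow> real \<Rightarrow> real set" where
  "jump_set \<alpha> \<beta> n s =
     (\<Union>j<n. \<Union>b\<in>insert 0 (range (($) \<beta>)). {x\<in>{0..<1}. 1 - s \<le> frac (x + (real j * \<alpha> + b))})"

lemma emeasure_near_one_le:
  assumes "0 \<le> s"
  shows "emeasure circle {x\<in>{0..<1}. 1 - s \<le> frac (x + c)} \<le> ennreal s"
proof -
  \<comment> \<open>For s > 1 the condition holds everywhere; the maximum keeps the interval inside
    [0,1).\<close>
  let ?I = "{max 0 (1 - s)..<1}"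
  have I: "?I \<in> sets circle" by (auto simp: sets_circle_iff)
  have "{x\<in>{0..<1}. 1 - s \<le> frac (x + c)} = rotation c -` ?I \<inter> space circle"
    by (auto simp: rotation_def frac_lt_1)
  then have "emeasure circle {x\<in>{0..<1}. 1 - s \<le> frac (x + c)} = emeasure (distr circle circle (rotation c)) ?I"
    by (simp add: emeasure_distr[OF measurable_rotation I])
  also have "\<dots> = ennreal (1 - max 0 (1 - s))"
    unfolding distr_rotation using assms by (subst emeasure_circle) (auto simp: max_def)
  also have "\<dots> \<le> ennreal s" by (intro ennreal_leI) auto
  finally show ?thesis .
qed

lemma jump_set_measurable [measurable]: "jump_set \<alpha> \<beta> n s \<in> sets borel"
  unfolding jump_set_def by (intro sets.finite_UN) auto

lemma jump_set_subset: "jump_set \<alpha> \<beta> n s \<subseteq> {0..<1}"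
  unfolding jump_set_def by auto

text \<open>A union bound over n(d + 1) arcs of length s. With s = t/n it becomes (d + 1)t, whatever
  n is.\<close>

lemma emeasure_jump_set_le:
  fixes \<beta> :: "real ^ 'd"
  assumes "0 \<le> s"
  shows "emeasure circle (jump_set \<alpha> \<beta> n s) \<le> ennreal (real (CARD('d) + 1) * (real n * s))"
proof -
  let ?B = "insert 0 (range (($) \<beta>))"
  let ?J = "\<lambda>j b. {x\<in>{0..<1}. 1 - s \<le> frac (x + (real j * \<alpha> + b))}"
  have J: "?J j b \<in> sets circle" for j b
    by (auto simp: sets_circle_iff)
  have J': "(\<Union>b\<in>?B. ?J j b) \<in> sets circle" for j
    by (intro sets.finite_UN J) simp
  have "emeasure circle (jump_set \<alpha> \<beta> n s) \<le> (\<Sum>j<n. emeasure circle (\<Union>b\<in>?B. ?J j b))"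
    unfolding jump_set_def by (intro emeasure_subadditive_finite image_subsetI J') simp
  also have "\<dots> \<le> (\<Sum>j<n. \<Sum>b\<in>?B. emeasure circle (?J j b))"
    by (intro sum_mono emeasure_subadditive_finite image_subsetI J) simp
  also have "\<dots> \<le> (\<Sum>j<n. \<Sum>b\<in>?B. ennreal s)"
    by (intro sum_mono emeasure_near_one_le assms)
  also have "\<dots> = ennreal (real n * (real (card ?B) * s))"
    using assms by (simp add: ennreal_mult'' ennreal_of_nat_eq_real_of_nat ac_simps)
  also have "\<dots> \<le> ennreal (real (CARD('d) + 1) * (real n * s))"
  proof (rule ennreal_leI)
    \<comment> \<open>The shifts may coincide or vanish, so d + 1 is only an upper bound for their
      number.\<close>
    have "card ?B \<le> Suc (card (range (($) \<beta>)))" by (rule card_insert_le_m1) auto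
    also have "\<dots> \<le> CARD('d) + 1" using card_image_le[of UNIV "($) \<beta>"] by simp
    finally have "real (card ?B) * (real n * s) \<le> real (CARD('d) + 1) * (real n * s)"
      using assms by (intro mult_right_mono) (auto simp del: of_nat_add)
    then show "real n * (real (card ?B) * s) \<le> real (CARD('d) + 1) * (real n * s)"
      by (simp only: mult.left_commute)
  qed
  finally show ?thesis .
qed

lemma sawtooth_sum_shift:
  fixes \<beta> :: "real ^ 'd"
  assumes s: "0 \<le> s" and x: "x \<in> {0..<1}" "x \<notin> jump_set \<alpha> \<beta> n s"
  shows "birkhoff_sum \<alpha> (sawtooth_cocycle \<beta>) n (x + s)
       = birkhoff_sum \<alpha> (sawtooth_cocycle \<beta>) n x + diag (real n * s)"
proof -
  have shift: "sawtooth (x + s + real j * \<alpha> + b) = sawtooth (x + real j * \<alpha> + b) + s"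
    if "j < n" "b \<in> insert 0 (range (($) \<beta>))" for j b
  proof -
    have "frac (x + (real j * \<alpha> + b)) < 1 - s"
      using x that unfolding jump_set_def by (auto simp: not_le)
    then have "frac (frac (x + (real j * \<alpha> + b)) + s) = frac (x + (real j * \<alpha> + b)) + s"
      using s by (simp add: frac_eq add_nonneg_nonneg del: frac_add_simps)
    then show ?thesis by (simp add: sawtooth_def add_ac)
  qed
  have "sawtooth_cocycle \<beta> (x + s + real j * \<alpha>) = sawtooth_cocycle \<beta> (x + real j * \<alpha>) + diag s"
    if "j < n" for j
    using shift[OF that, of 0] shift[OF that]
    by (simp add: sawtooth_cocycle_def diag_def vec_eq_iff)
  then have "birkhoff_sum \<alpha> (sawtooth_cocycle \<beta>) n (x + s)
       = birkhoff_sum \<alpha> (sawtooth_cocycle \<beta>) n x + (\<Sum>j<n. diag s)"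
    by (simp add: birkhoff_sum_def sum.distrib)
  also have "(\<Sum>j<n. diag s) = (diag (real n * s) :: real \<times> (real ^ 'd))"
    by (induction n) (auto simp: diag_add[symmetric] algebra_simps)
  finally show ?thesis .
qed

text \<open>The exceptional set lies in the base and is common to all w. Its preimages under
  rotations are null again, so no null set of the fibre has to be carried along the orbit.\<close>

lemma invariant_iterate:
  fixes A :: "(real \<times> (real \<times> (real ^ 'd))) set"
  assumes "AE x in circle. \<forall>w. (rotation \<alpha> x, w + sawtooth_cocycle \<beta> x) \<in> A \<longleftrightarrow> (x, w) \<in> A"
  shows "AE x in circle. \<forall>w. (rotation (real n * \<alpha>) x, w + birkhoff_sum \<alpha> (sawtooth_cocycle \<beta>) n x) \<in> A
           \<longleftrightarrow> (x, w) \<in> A"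
proof (induction n)
  case 0
  show ?case
    by (rule AE_I2) (simp add: rotation_def birkhoff_sum_def)
next
  case (Suc n)
  have "AE x in distr circle circle (rotation (real n * \<alpha>)).
      \<forall>w. (rotation \<alpha> x, w + sawtooth_cocycle \<beta> x) \<in> A \<longleftrightarrow> (x, w) \<in> A"
    unfolding distr_rotation by fact
  from AE_distrD[OF measurable_rotation this] Suc
  show ?case
  proof eventually_elim
    case (elim x)
    have "rotation \<alpha> (rotation (real n * \<alpha>) x) = rotation (real (Suc n) * \<alpha>) x"
      by (simp add: rotation_def algebra_simps)
    moreover have "sawtooth_cocycle \<beta> (rotation (real n * \<alpha>) x) = sawtooth_cocycle \<beta> (x + real n * \<alpha>)"
      by (simp add: rotation_def sawtooth_cocycle_frac)
    moreover have "w + birkhoff_sum \<alpha> (sawtooth_cocycle \<beta>) (Suc n) x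
        = w + birkhoff_sum \<alpha> (sawtooth_cocycle \<beta>) n x + sawtooth_cocycle \<beta> (x + real n * \<alpha>)" for w
      by (simp only: birkhoff_sum_def sum.lessThan_Suc add.assoc)
    ultimately show ?case
      using elim by metis
  qed
qed

section \<open>Translation in the base\<close>

lemma emeasure_vimage_translation:
  fixes v :: "'a::euclidean_space"
  assumes "B \<in> sets borel"
  shows "emeasure lborel {z. z + v \<in> B} = emeasure lborel B"
  using haar_vimage_translation[OF closed_subgroup_UNIV haar_lborel UNIV_I, of B v] assms by simp

text \<open>A is squeezed between a compact K and an open U with small differences. If the
  \<delta>-neighbourhood of K lies in U, a point moved by less than \<delta> leaves A only from A -
  K or into U - A.\<close>

lemma translation_continuous_in_measure:
  fixes A :: "'a::euclidean_space set"
  assumes A: "A \<in> sets borel" "bounded A" and e: "0 < e"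
  obtains \<delta> where "0 < \<delta>" "\<And>v. norm v < \<delta> \<Longrightarrow> emeasure lborel {z\<in>A. z + v \<notin> A} \<le> ennreal e"
    "\<And>v. norm v < \<delta> \<Longrightarrow> emeasure lborel {z. z \<notin> A \<and> z + v \<in> A} \<le> ennreal e"
proof -
  have [measurable]: "A \<in> sets borel" by fact
  obtain U where U: "open U" "A \<subseteq> U" "emeasure lborel (U - A) < ennreal (e / 2)"
    by (rule outer_regular_lborel[OF A(1) half_gt_zero[OF e]])
  have "A \<in> sets lebesgue" using A by auto
  then obtain K where K: "closed K" "K \<subseteq> A" "A - K \<in> lmeasurable" "emeasure lebesgue (A - K) < ennreal (e / 2)"
    by (rule sets_lebesgue_inner_closed[OF _ half_gt_zero[OF e]])
  have [measurable]: "U \<in> sets borel" "K \<in> sets borel" using U K by auto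
  have K': "emeasure lborel (A - K) < ennreal (e / 2)"
    using K(4) by simp
  have "compact K" using K A(2) bounded_subset compact_eq_bounded_closed by blast
  then obtain \<delta> where \<delta>: "0 < \<delta>" "(\<Union>x\<in>K. ball x \<delta>) \<subseteq> U"
    by (rule compact_subset_open_imp_ball_epsilon_subset[OF _ U(1) order_trans[OF K(2) U(2)]])
  have 1: "emeasure lborel {z\<in>A. z + v \<notin> A} \<le> ennreal e" if v: "norm v < \<delta>" for v
  proof -
    have "{z\<in>A. z + v \<notin> A} \<subseteq> (A - K) \<union> {z. z + v \<in> U - A}"
    proof
      fix z assume z: "z \<in> {z\<in>A. z + v \<notin> A}"
      show "z \<in> (A - K) \<union> {z. z + v \<in> U - A}"
      proof (cases "z \<in> K")
        case True
        moreover have "z + v \<in> ball z \<delta>" using v by (simp add: dist_norm)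
        ultimately have "z + v \<in> U" using \<delta>(2) by blast
        then show ?thesis using z by auto
      qed (use z in auto)
    qed
    then have "emeasure lborel {z\<in>A. z + v \<notin> A} \<le> emeasure lborel ((A - K) \<union> {z. z + v \<in> U - A})"
      by (intro emeasure_mono) auto
    also have "\<dots> \<le> emeasure lborel (A - K) + emeasure lborel {z. z + v \<in> U - A}"
      by (intro emeasure_subadditive) auto
    also have "emeasure lborel {z. z + v \<in> U - A} = emeasure lborel (U - A)"
      by (rule emeasure_vimage_translation) auto
    also have "emeasure lborel (A - K) + emeasure lborel (U - A) \<le> ennreal (e / 2) + ennreal (e / 2)"
      by (intro add_mono less_imp_le K' U(3))
    also have "\<dots> = ennreal e" using e by (simp add: ennreal_plus[symmetric] del: ennreal_plus)
    finally show ?thesis .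
  qed
  moreover have "emeasure lborel {z. z \<notin> A \<and> z + v \<in> A} \<le> ennreal e" if v: "norm v < \<delta>" for v
  proof -
    \<comment> \<open>Entering A under v is leaving A under -v, seen from the endpoint.\<close>
    have "emeasure lborel {z. z \<notin> A \<and> z + v \<in> A} = emeasure lborel {z. z + v \<in> {z\<in>A. z + (- v) \<notin> A}}"
      by (rule arg_cong[of _ _ "emeasure lborel"]) auto
    also have "\<dots> = emeasure lborel {z\<in>A. z + (- v) \<notin> A}"
      by (rule emeasure_vimage_translation) measurable
    finally show ?thesis using 1[of "- v"] v by simp
  qed
  ultimately show thesis using \<delta>(1) by (intro that) auto
qed

lemma measurable_fst_circle [measurable]:
  "fst \<in> borel_measurable (circle \<Otimes>\<^sub>M N)"
  by (rule measurable_compose[OF measurable_fst measurable_id_circle])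

lemma measurable_rotation_borel [measurable]: "rotation c \<in> borel_measurable borel"
  unfolding rotation_def[abs_def] by measurable

lemma emeasure_circle_pair_lborel:
  fixes B :: "(real \<times> 'a::euclidean_space) set"
  assumes B: "B \<in> sets borel" "B \<subseteq> {0..<1} \<times> UNIV"
  shows "B \<in> sets (circle \<Otimes>\<^sub>M lborel)"
    and "emeasure (circle \<Otimes>\<^sub>M lborel) B = emeasure lborel B"
proof -
  have [measurable]: "B \<in> sets (borel \<Otimes>\<^sub>M borel)" using B unfolding borel_prod by simp
  have B': "B \<in> sets (lborel \<Otimes>\<^sub>M lborel)" using B unfolding lborel_prod by simp
  have "{z\<in>space (circle \<Otimes>\<^sub>M (lborel :: 'a measure)). (fst z, snd z) \<in> B} \<in> sets (circle \<Otimes>\<^sub>M lborel)"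
    by measurable
  moreover have "{z\<in>space (circle \<Otimes>\<^sub>M (lborel :: 'a measure)). (fst z, snd z) \<in> B} = B"
    using B(2) by (auto simp: space_pair_measure)
  ultimately show B1: "B \<in> sets (circle \<Otimes>\<^sub>M lborel)" by simp
  have "emeasure (circle \<Otimes>\<^sub>M lborel) B = (\<integral>\<^sup>+x. emeasure lborel (Pair x -` B) \<partial>circle)"
    by (rule lborel.emeasure_pair_measure_alt[OF B1])
  also have "\<dots> = (\<integral>\<^sup>+x. emeasure lborel (Pair x -` B) * indicator {0..<1} x \<partial>lborel)"
    unfolding circle_def by (rule nn_integral_restrict_space) auto
  also have "\<dots> = (\<integral>\<^sup>+x. emeasure lborel (Pair x -` B) \<partial>lborel)"
  proof (rule nn_integral_cong)
    fix x :: real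
    show "emeasure lborel (Pair x -` B) * indicator {0..<1} x = emeasure lborel (Pair x -` B)"
    proof (cases "x \<in> {0..<1}")
      case False
      then have "Pair x -` B = {}" using B(2) by auto
      then show ?thesis by simp
    qed simp
  qed
  also have "\<dots> = emeasure (lborel \<Otimes>\<^sub>M lborel) B"
    by (rule lborel.emeasure_pair_measure_alt[OF B', symmetric])
  finally show "emeasure (circle \<Otimes>\<^sub>M lborel) B = emeasure lborel B"
    by (simp add: lborel_prod)
qed

lemma circle_translation_continuous_in_measure:
  fixes A :: "(real \<times> 'a::euclidean_space) set"
  assumes A: "A \<in> sets borel" and e: "0 < e"
  obtains \<delta> where "0 < \<delta>" "\<And>s. 0 \<le> s \<Longrightarrow> s < \<delta> \<Longrightarrow>
    emeasure (circle \<Otimes>\<^sub>M lborel)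
      {z \<in> {0..<1} \<times> UNIV. norm (snd z) \<le> R \<and> ((rotation s (fst z), snd z) \<in> A \<longleftrightarrow> z \<notin> A)} \<le> ennreal e"
proof -
  have [measurable]: "A \<in> sets (borel \<Otimes>\<^sub>M borel)" using A unfolding borel_prod by simp
  \<comment> \<open>A is unrolled over [0,2], so that for s < 1 the rotation of a point of [0,1)
    becomes the plain translation by s; the cut at R makes the set bounded.\<close>
  define A' where "A' = {z. fst z \<in> {0..2} \<and> norm (snd z) \<le> R \<and> (frac (fst z), snd z) \<in> A}"
  have "{z \<in> space (borel \<Otimes>\<^sub>M borel). fst z \<in> {0..2} \<and> norm (snd z) \<le> R \<and> (frac (fst z), snd z) \<in> A}
      \<in> sets (borel \<Otimes>\<^sub>M borel)" by measurable
  then have [measurable]: "A' \<in> sets (borel \<Otimes>\<^sub>M borel)" by (simp add: A'_def space_pair_measure)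
  then have A'_m: "A' \<in> sets borel" unfolding borel_prod .
  have "A' \<subseteq> {0..2} \<times> cball 0 R" by (auto simp: A'_def)
  then have "bounded A'" by (rule bounded_subset[rotated]) (intro bounded_Times bounded_closed_interval bounded_cball)
  then obtain \<delta> where \<delta>: "0 < \<delta>"
    "\<And>v. norm v < \<delta> \<Longrightarrow> emeasure lborel {z\<in>A'. z + v \<notin> A'} \<le> ennreal (e / 2)"
    "\<And>v. norm v < \<delta> \<Longrightarrow> emeasure lborel {z. z \<notin> A' \<and> z + v \<in> A'} \<le> ennreal (e / 2)"
    by (rule translation_continuous_in_measure[OF A'_m _ half_gt_zero[OF e]]) blast
  show thesis
  proof (rule that)
    show "0 < min \<delta> 1" using \<delta> by simp
    fix s :: real assume s: "0 \<le> s" "s < min \<delta> 1"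
    let ?v = "(s, 0 :: 'a)"
    let ?Y = "{z \<in> {0..<1} \<times> UNIV. norm (snd z) \<le> R \<and> ((rotation s (fst z), snd z) \<in> A \<longleftrightarrow> z \<notin> A)}"
    have "?Y = {z \<in> space (borel \<Otimes>\<^sub>M borel). fst z \<in> {0..<1} \<and> norm (snd z) \<le> R \<and> ((rotation s (fst z), snd z) \<in> A \<longleftrightarrow> z \<notin> A)}"
      by (auto simp: space_pair_measure)
    also have "\<dots> \<in> sets (borel \<Otimes>\<^sub>M borel)" by measurable
    finally have Y: "?Y \<in> sets borel" unfolding borel_prod .
    have m: "{z\<in>A'. z + ?v \<notin> A'} \<in> sets lborel" "{z. z \<notin> A' \<and> z + ?v \<in> A'} \<in> sets lborel"
      using A'_m by auto
    have "?Y \<subseteq> {z\<in>A'. z + ?v \<notin> A'} \<union> {z. z \<notin> A' \<and> z + ?v \<in> A'}"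
      using s by (auto simp: A'_def rotation_def)
    then have "emeasure lborel ?Y \<le> emeasure lborel ({z\<in>A'. z + ?v \<notin> A'} \<union> {z. z \<notin> A' \<and> z + ?v \<in> A'})"
      using m by (intro emeasure_mono) auto
    also have "\<dots> \<le> emeasure lborel {z\<in>A'. z + ?v \<notin> A'} + emeasure lborel {z. z \<notin> A' \<and> z + ?v \<in> A'}"
      using m by (intro emeasure_subadditive)
    also have "\<dots> \<le> ennreal (e / 2) + ennreal (e / 2)"
      using s by (intro add_mono \<delta>) (auto simp: norm_Pair)
    also have "\<dots> = ennreal e" using e by (simp add: ennreal_plus[symmetric] del: ennreal_plus)
    finally show "emeasure (circle \<Otimes>\<^sub>M lborel) ?Y \<le> ennreal e"
      by (subst emeasure_circle_pair_lborel) (use Y in auto)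
  qed
qed

section \<open>Invariance under the diagonal flow\<close>

text \<open>Failure of invariance over x is expressed by a measure instead of an almost-everywhere
  statement, because this is a measurable function of x and a positive value admits a quantitative
  lower bound. The ball keeps the fibre coordinate in a fixed bounded range.\<close>

definition defect :: "(real \<times> 'a::euclidean_space) set \<Rightarrow> 'a \<Rightarrow> nat \<Rightarrow> real \<Rightarrow> ennreal" where
  "defect A v n x = emeasure lborel {w. norm w \<le> real n \<and> ((x, w + v) \<in> A \<longleftrightarrow> (x, w) \<notin> A)}"

lemma sets_defect:
  fixes A :: "(real \<times> 'a::euclidean_space) set"
  assumes [measurable]: "A \<in> sets (borel \<Otimes>\<^sub>M borel)"
  shows "{w. norm w \<le> real n \<and> ((x, w + v) \<in> A \<longleftrightarrow> (x, w) \<notin> A)} \<in> sets borel"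
proof -
  have "{w \<in> space borel. norm w \<le> real n \<and> ((x, w + v) \<in> A \<longleftrightarrow> (x, w) \<notin> A)} \<in> sets borel"
    by measurable
  then show ?thesis by simp
qed

lemma measurable_defect:
  fixes A :: "(real \<times> 'a::euclidean_space) set"
  assumes [measurable]: "A \<in> sets (borel \<Otimes>\<^sub>M borel)"
  shows "defect A v n \<in> borel_measurable borel"
proof -
  let ?Q = "{z \<in> space (borel \<Otimes>\<^sub>M (lborel :: 'a measure)). norm (snd z) \<le> real n \<and>
      ((fst z, snd z + v) \<in> A \<longleftrightarrow> (fst z, snd z) \<notin> A)}"
  have "?Q \<in> sets (borel \<Otimes>\<^sub>M lborel)" by measurable
  from lborel.measurable_emeasure_Pair[OF this] show ?thesis
    by (simp add: defect_def[abs_def] space_pair_measure vimage_def)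
qed

lemma defect_mono:
  fixes A :: "(real \<times> 'a::euclidean_space) set"
  assumes "A \<in> sets (borel \<Otimes>\<^sub>M borel)" "m \<le> n"
  shows "defect A v m x \<le> defect A v n x"
  unfolding defect_def using sets_defect[OF assms(1)] assms(2)
  by (intro emeasure_mono) auto

lemma AE_eq_translate_iff_defect:
  fixes A :: "(real \<times> 'a::euclidean_space) set"
  assumes "A \<in> sets (borel \<Otimes>\<^sub>M borel)"
  shows "(AE w in lborel. (x, w + v) \<in> A \<longleftrightarrow> (x, w) \<in> A) \<longleftrightarrow> (\<forall>n. defect A v n x = 0)"
proof -
  let ?D = "\<lambda>n. {w. norm w \<le> real n \<and> ((x, w + v) \<in> A \<longleftrightarrow> (x, w) \<notin> A)}"
  have "defect A v n x = 0 \<longleftrightarrow> (AE w in lborel. w \<notin> ?D n)" for n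
  proof -
    have D: "?D n \<in> sets lborel" using sets_defect[OF assms] by simp
    have "defect A v n x = 0 \<longleftrightarrow> ?D n \<in> null_sets lborel"
      unfolding defect_def by (rule iffI[OF null_setsI[OF _ D] null_setsD1])
    then show ?thesis by (simp only: AE_iff_null_sets[OF D])
  qed
  then have "(\<forall>n. defect A v n x = 0) \<longleftrightarrow> (\<forall>n. AE w in lborel. w \<notin> ?D n)"
    by simp
  also have "\<dots> \<longleftrightarrow> (AE w in lborel. \<forall>n. w \<notin> ?D n)"
    by (rule AE_all_countable[symmetric])
  also have "\<dots> \<longleftrightarrow> (AE w in lborel. (x, w + v) \<in> A \<longleftrightarrow> (x, w) \<in> A)"
    by (rule AE_cong) (use real_arch_simple in blast)
  finally show ?thesis by simp
qed

lemma emeasure_vimage_skew_product: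
  fixes v :: "real \<Rightarrow> 'a::euclidean_space"
  assumes "v \<in> borel_measurable circle" "Y \<in> sets (circle \<Otimes>\<^sub>M lborel)"
  shows "skew_product (rotation c) v -` Y \<inter> space (circle \<Otimes>\<^sub>M lborel) \<in> sets (circle \<Otimes>\<^sub>M lborel)"
    and "emeasure (circle \<Otimes>\<^sub>M lborel) (skew_product (rotation c) v -` Y \<inter> space (circle \<Otimes>\<^sub>M lborel))
       = emeasure (circle \<Otimes>\<^sub>M lborel) Y"
proof -
  have v: "cocycle v" using assms(1) by (simp add: cocycle_def)
  note S = skew_product_measurable[OF closed_subgroup_UNIV haar_lborel v, of c] distr_skew_product[OF closed_subgroup_UNIV haar_lborel v, of c]
  show "skew_product (rotation c) v -` Y \<inter> space (circle \<Otimes>\<^sub>M lborel) \<in> sets (circle \<Otimes>\<^sub>M lborel)"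
    by (rule measurable_sets[OF S(1) assms(2)]) simp
  show "emeasure (circle \<Otimes>\<^sub>M lborel) (skew_product (rotation c) v -` Y \<inter> space (circle \<Otimes>\<^sub>M lborel))
       = emeasure (circle \<Otimes>\<^sub>M lborel) Y"
    using emeasure_distr[OF S(1) assms(2)] S(2) by simp
qed

text \<open>If the bound failed, the defect would exceed a fixed level on a set of measure (d + 1)t
  + c. Whatever q is, jumps remove at most (d + 1)t of it, so failures of a definite total measure,
  proportional to c, would remain; but off the jumps they can only come from two base shifts by t/q,
  whose effect tends to 0.\<close>

lemma emeasure_defect_le:
  fixes A :: "(real \<times> (real \<times> (real ^ 'd))) set" and \<beta> :: "real ^ 'd"
  assumes \<alpha>: "\<alpha> \<notin> \<rat>" and A: "A \<in> sets (borel \<Otimes>\<^sub>M borel)" and t: "0 < t"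
    and inv: "AE x in circle. \<forall>w. (rotation \<alpha> x, w + sawtooth_cocycle \<beta> x) \<in> A \<longleftrightarrow> (x, w) \<in> A"
  shows "emeasure circle {x\<in>{0..<1}. \<exists>n. defect A (diag t) n x \<noteq> 0} \<le> ennreal (real (CARD('d) + 1) * t)"
proof (rule ccontr)
  assume contra: "\<not> ?thesis"
  define \<kappa> where "\<kappa> = real (CARD('d) + 1)"
  have \<kappa>: "0 \<le> \<kappa>" by (simp add: \<kappa>_def)
  have [measurable]: "A \<in> sets (borel \<Otimes>\<^sub>M borel)" by fact
  have [measurable]: "defect A (diag t) n \<in> borel_measurable borel" for n
    by (rule measurable_defect[OF A])
  \<comment> \<open>One index serves as radius of the ball and as inverse threshold. Since the
    defect grows with the radius, these sets increase to the whole bad set.\<close>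
  define E where "E n = {x\<in>{0..<1}. ennreal (1 / (real n + 1)) < defect A (diag t) n x}" for n
  have E_sets [measurable]: "E n \<in> sets circle" for n
    by (auto simp: E_def sets_circle_iff)
  have "incseq E"
  proof (rule incseq_SucI, rule subsetI)
    fix n x assume x: "x \<in> E n"
    have "ennreal (1 / (real (Suc n) + 1)) \<le> ennreal (1 / (real n + 1))"
      by (intro ennreal_leI frac_le) auto
    also have "\<dots> < defect A (diag t) n x" using x by (simp add: E_def)
    also have "\<dots> \<le> defect A (diag t) (Suc n) x" by (rule defect_mono[OF A]) simp
    finally show "x \<in> E (Suc n)" using x by (simp add: E_def)
  qed
  have "{x\<in>{0..<1}. \<exists>n. defect A (diag t) n x \<noteq> 0} = (\<Union>n. E n)"
  proof (intro equalityI subsetI)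
    fix x assume "x \<in> {x\<in>{0..<1}. \<exists>n. defect A (diag t) n x \<noteq> 0}"
    then obtain n where x: "x \<in> {0..<1}" and n: "0 < defect A (diag t) n x"
      by (auto simp: zero_less_iff_neq_zero)
    obtain r where r: "0 < r" "ennreal r < defect A (diag t) n x"
    proof -
      obtain y where y: "0 < y" "y < defect A (diag t) n x" using dense[OF n] by blast
      then have "y < top" by (metis less_le_trans top_greatest)
      then show thesis using y by (intro that[of "enn2real y"]) (auto simp: enn2real_positive_iff)
    qed
    obtain m where m: "1 / (real m + 1) < r"
      using nat_approx_posE[OF r(1)] by (metis of_nat_Suc add.commute)
    let ?k = "max m n"
    have "1 / (real ?k + 1) \<le> 1 / (real m + 1)" by (intro frac_le) auto
    with m have "ennreal (1 / (real ?k + 1)) \<le> ennreal r" by (intro ennreal_leI) simp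
    also have "\<dots> < defect A (diag t) n x" by fact
    also have "\<dots> \<le> defect A (diag t) ?k x" by (rule defect_mono[OF A]) simp
    finally show "x \<in> (\<Union>n. E n)" using x by (auto simp: E_def)
  next
    fix x assume "x \<in> (\<Union>n. E n)"
    then obtain n where "x \<in> E n" by blast
    then show "x \<in> {x\<in>{0..<1}. \<exists>n. defect A (diag t) n x \<noteq> 0}"
      unfolding E_def by (auto intro!: exI[of _ n] dest: gr_implies_not_zero)
  qed
  then have "(SUP n. emeasure circle (E n)) = emeasure circle {x\<in>{0..<1}. \<exists>n. defect A (diag t) n x \<noteq> 0}"
    using SUP_emeasure_incseq[OF image_subsetI \<open>incseq E\<close>, of circle] E_sets by simp
  then have "ennreal (\<kappa> * t) < (SUP n. emeasure circle (E n))"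
    using contra by (simp add: \<kappa>_def not_le)
  then obtain n where n: "ennreal (\<kappa> * t) < emeasure circle (E n)"
    by (auto simp: less_SUP_iff)
  define c where "c = measure circle (E n) - \<kappa> * t"
  have c: "0 < c"
    using n \<kappa> t by (simp add: c_def circle.emeasure_eq_measure ennreal_less_iff)
  \<comment> \<open>Makes 2\<epsilon> half of c / (n + 1), the lower bound for the measure of
    \<open>Z\<close> obtained below.\<close>
  define \<epsilon> where "\<epsilon> = c / (4 * (real n + 1))"
  have \<epsilon>: "0 < \<epsilon>" using c by (simp add: \<epsilon>_def)
  \<comment> \<open>The fibre points compared below are w - Sx and w + diag t with norm of w at most
    n, where S is the q-th sum. The radius does not depend on q, so \<delta> can be fixed before
    q.\<close>
  define R where "R = real n + 5 * (1 + CARD('d)) + norm (diag t :: real \<times> (real ^ 'd))"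
  have "A \<in> sets borel" using A unfolding borel_prod .
  then obtain \<delta> where \<delta>: "0 < \<delta>" "\<And>s. 0 \<le> s \<Longrightarrow> s < \<delta> \<Longrightarrow>
    emeasure (circle \<Otimes>\<^sub>M lborel)
      {z \<in> {0..<1} \<times> UNIV. norm (snd z) \<le> R \<and> ((rotation s (fst z), snd z) \<in> A \<longleftrightarrow> z \<notin> A)} \<le> ennreal \<epsilon>"
    by (rule circle_translation_continuous_in_measure[OF _ \<epsilon>]) blast
  obtain Q :: "nat \<Rightarrow> nat" where Q: "strict_mono Q" "\<And>n. 0 < Q n"
    "\<And>n x. \<bar>\<Sum>j<Q n. sawtooth (x + real j * \<alpha>)\<bar> \<le> 5"
    by (rule bounded_sawtooth_sums[OF \<alpha>]) blast
  obtain k :: nat where k: "t / \<delta> < real k" using reals_Archimedean2 by blast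
  define q where "q = Q k"
  have q: "0 < q" "t / \<delta> < real q"
    using Q(2) k seq_suble[OF Q(1), of k] by (auto simp: q_def intro: less_le_trans)
  \<comment> \<open>With slope 1 in each of q terms, a base shift by s becomes a fibre shift by
    exactly t.\<close>
  define s where "s = t / q"
  have s: "0 \<le> s" "s < \<delta>" "real q * s = t"
    using q t \<delta>(1) by (auto simp: s_def field_simps)
  let ?M = "circle \<Otimes>\<^sub>M (lborel :: (real \<times> (real ^ 'd)) measure)"
  let ?S = "birkhoff_sum \<alpha> (sawtooth_cocycle \<beta>) q"
  let ?\<rho> = "rotation (real q * \<alpha>)"
  have [simp]: "space ?M = {0..<1} \<times> UNIV" by (auto simp: space_pair_measure)
  obtain N where N: "\<And>x. x \<in> space circle - N \<Longrightarrow> \<forall>w. (?\<rho> x, w + ?S x) \<in> A \<longleftrightarrow> (x, w) \<in> A"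
    "N \<in> null_sets circle"
    by (rule AE_E3[OF invariant_iterate[OF inv, of q]]) blast
  \<comment> \<open>Invariance along q steps is applied both at x and at x + s, so both points must
    avoid \<open>N\<close>.\<close>
  define N' where "N' = rotation s -` N \<inter> space circle"
  have N'_sets: "N' \<in> sets circle"
    unfolding N'_def by (rule measurable_sets[OF measurable_rotation]) (use N(2) in auto)
  have N': "N' \<in> null_sets circle"
    using N'_sets N(2) emeasure_distr[OF measurable_rotation, of N s]
    by (auto simp: null_sets_def N'_def distr_rotation)
  define B where "B = jump_set \<alpha> \<beta> q s \<union> N \<union> N'"
  have J: "jump_set \<alpha> \<beta> q s \<in> sets circle"
    by (simp add: sets_circle_iff jump_set_subset)
  have B [measurable]: "B \<in> sets circle"
    using J N(2) N' by (auto simp: B_def)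
  have "emeasure circle B = emeasure circle (jump_set \<alpha> \<beta> q s)"
    using J N(2) N' by (simp add: B_def emeasure_Un_null_set sets.Un null_setsD2)
  also have "\<dots> \<le> ennreal (\<kappa> * t)"
    using emeasure_jump_set_le[OF s(1), of \<alpha> \<beta> q] s(3) by (simp add: \<kappa>_def)
  finally have "measure circle B \<le> \<kappa> * t"
    using \<kappa> t by (simp add: circle.emeasure_eq_measure)
  \<comment> \<open>The failure is read over x + q\<alpha> but indexed by x, because the point that
    must avoid the jumps is the one reached by going back q steps.\<close>
  define Z where "Z = {z \<in> space ?M. fst z \<notin> B \<and> norm (snd z) \<le> real n \<and>
      ((?\<rho> (fst z), snd z + diag t) \<in> A \<longleftrightarrow> (?\<rho> (fst z), snd z) \<notin> A)}"
  have Z: "Z \<in> sets ?M" unfolding Z_def by measurable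
  define Y where "Y = {z \<in> {0..<1} \<times> UNIV. norm (snd z) \<le> R \<and> ((rotation s (fst z), snd z) \<in> A \<longleftrightarrow> z \<notin> A)}"
  have "Y = {z \<in> space ?M. norm (snd z) \<le> R \<and> ((rotation s (fst z), snd z) \<in> A \<longleftrightarrow> (fst z, snd z) \<notin> A)}"
    by (auto simp: Y_def)
  also have "\<dots> \<in> sets ?M" by measurable
  finally have Y: "Y \<in> sets ?M" .
  \<comment> \<open>Both are preimages of \<open>Y\<close> under measure-preserving maps. The first
    tests the base shift at (x, w - Sx), the base being fixed by the rotation by 0; the second tests
    it at (x + q\<alpha>, w + diag t).\<close>
  let ?Y1 = "skew_product (rotation 0) (\<lambda>x. - ?S x) -` Y \<inter> space ?M"
  let ?Y2 = "skew_product ?\<rho> (\<lambda>_. diag t) -` Y \<inter> space ?M"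
  have mS: "(\<lambda>x. - ?S x) \<in> borel_measurable circle"
    by (rule measurable_circle_restrict) measurable
  have mc: "(\<lambda>_. diag t :: real \<times> (real ^ 'd)) \<in> borel_measurable circle" by simp
  note Y1 = emeasure_vimage_skew_product[OF mS Y, of 0] and Y2 = emeasure_vimage_skew_product[OF mc Y, of "real q * \<alpha>"]
  \<comment> \<open>With y = x + q\<alpha>, membership in A is compared along (y, w), (x, w - Sx),
    (x + s, w - Sx), (y + s, w + diag t), (y, w + diag t). Links one and three hold outside
    \<open>B\<close> by q-step invariance; link two fails only on \<open>?Y1\<close>, link four only
    on \<open>?Y2\<close>.\<close>
  have "Z \<subseteq> ?Y1 \<union> ?Y2"
  proof (rule subsetI, rule ccontr)
    fix z assume z: "z \<in> Z" and nz: "z \<notin> ?Y1 \<union> ?Y2"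
    obtain x w where xw: "z = (x, w)" by (cases z)
    have x: "x \<in> {0..<1}" "x \<notin> N" "rotation s x \<notin> N" "x \<notin> jump_set \<alpha> \<beta> q s"
      using z by (auto simp: Z_def B_def N'_def xw)
    have w: "norm w \<le> real n" "(?\<rho> x, w + diag t) \<in> A \<longleftrightarrow> (?\<rho> x, w) \<notin> A"
      using z by (auto simp: Z_def xw)
    have bd: "norm (?S x) \<le> 5 * (1 + CARD('d))"
      using norm_sawtooth_sum_le[where n = "Q k" and \<alpha> = \<alpha> and C = 5 and \<beta> = \<beta> and x = x] Q(3)
      by (simp add: q_def)
    have "norm (w - ?S x) \<le> R"
      using norm_triangle_ineq4[of w "?S x"] w(1) bd by (simp add: R_def add_nonneg_nonneg add_increasing2)
    then have 1: "(rotation s x, w - ?S x) \<in> A \<longleftrightarrow> (x, w - ?S x) \<in> A"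
      using nz x(1) by (auto simp: xw Y_def skew_product_def rotation_def frac_eq_id)
    have "norm (w + diag t) \<le> R"
      using norm_triangle_ineq[of w "diag t"] w(1) by (simp add: R_def)
    then have 2: "(rotation s (?\<rho> x), w + diag t) \<in> A \<longleftrightarrow> (?\<rho> x, w + diag t) \<in> A"
      using nz x(1) by (auto simp: xw Y_def skew_product_def)
    have 3: "(?\<rho> x, w) \<in> A \<longleftrightarrow> (x, w - ?S x) \<in> A"
      using N(1)[of x] x by (metis DiffI diff_add_cancel space_circle)
    have "?S (rotation s x) = ?S x + diag t"
      using sawtooth_sum_shift[OF s(1) x(1,4)] s(3) by (simp add: rotation_def sawtooth_sum_frac)
    moreover have "\<forall>w. (?\<rho> (rotation s x), w + ?S (rotation s x)) \<in> A \<longleftrightarrow> (rotation s x, w) \<in> A"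
      by (rule N(1)) (use x in auto)
    from spec[OF this, of "w - ?S x"]
    have "(?\<rho> (rotation s x), w - ?S x + ?S (rotation s x)) \<in> A \<longleftrightarrow> (rotation s x, w - ?S x) \<in> A" .
    ultimately have "(?\<rho> (rotation s x), w + diag t) \<in> A \<longleftrightarrow> (rotation s x, w - ?S x) \<in> A"
      by (simp only: add.assoc[symmetric] diff_add_cancel)
    moreover have "?\<rho> (rotation s x) = rotation s (?\<rho> x)"
      by (simp add: rotation_def add_ac)
    ultimately show False using w(2) 1 2 3 by auto
  qed
  then have "emeasure ?M Z \<le> emeasure ?M (?Y1 \<union> ?Y2)"
    using Y1(1) Y2(1) by (intro emeasure_mono) auto
  also have "\<dots> \<le> emeasure ?M ?Y1 + emeasure ?M ?Y2"
    using Y1(1) Y2(1) by (intro emeasure_subadditive)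
  also have "\<dots> \<le> ennreal \<epsilon> + ennreal \<epsilon>"
    unfolding Y1(2) Y2(2) using \<delta>(2)[OF s(1,2)] by (intro add_mono) (simp_all add: Y_def)
  also have "\<dots> = ennreal (2 * \<epsilon>)" using \<epsilon> by (simp add: ennreal_plus[symmetric] del: ennreal_plus)
  finally have upper: "emeasure ?M Z \<le> ennreal (2 * \<epsilon>)" .
  \<comment> \<open>Rotation preserves the measure \<kappa>t + c of \<open>E n\<close>, so at least
    c of it is left after \<open>B\<close> is removed.\<close>
  define P where "P = ?\<rho> -` E n \<inter> space circle"
  have P: "P \<in> sets circle" unfolding P_def by (rule measurable_sets[OF measurable_rotation E_sets])
  have "emeasure circle P = emeasure circle (E n)"
    using emeasure_distr[OF measurable_rotation E_sets, of "real q * \<alpha>" n] by (simp add: P_def distr_rotation)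
  then have "measure circle P = measure circle (E n)" by (simp add: measure_def)
  moreover have "measure circle P \<le> measure circle ((P - B) \<union> B)"
    using P B by (intro circle.finite_measure_mono) auto
  moreover have "measure circle ((P - B) \<union> B) \<le> measure circle (P - B) + measure circle B"
    using P B by (intro measure_Un_le) auto
  ultimately have "c \<le> measure circle (P - B)"
    using \<open>measure circle B \<le> \<kappa> * t\<close> by (simp add: c_def)
  then have "ennreal (1 / (real n + 1) * c) \<le> ennreal (1 / (real n + 1)) * emeasure circle (P - B)"
    using c by (subst ennreal_mult'') (auto simp: circle.emeasure_eq_measure intro!: mult_left_mono ennreal_leI)
  also have "\<dots> = (\<integral>\<^sup>+x. ennreal (1 / (real n + 1)) * indicator (P - B) x \<partial>circle)"
    using P B by (subst nn_integral_cmult_indicator) auto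
  also have "\<dots> \<le> (\<integral>\<^sup>+x. emeasure lborel (Pair x -` Z) \<partial>circle)"
  proof (rule nn_integral_mono)
    fix x assume x: "x \<in> space circle"
    show "ennreal (1 / (real n + 1)) * indicator (P - B) x \<le> emeasure lborel (Pair x -` Z)"
    proof (cases "x \<in> P - B")
      case True
      then have "Pair x -` Z = {w. norm w \<le> real n \<and> ((?\<rho> x, w + diag t) \<in> A \<longleftrightarrow> (?\<rho> x, w) \<notin> A)}"
        using x by (auto simp: Z_def)
      then have "emeasure lborel (Pair x -` Z) = defect A (diag t) n (?\<rho> x)"
        by (simp add: defect_def)
      then show ?thesis using True by (auto simp: P_def E_def intro: less_imp_le)
    qed simp
  qed
  also have "\<dots> = emeasure ?M Z"
    by (rule lborel.emeasure_pair_measure_alt[OF Z, symmetric])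
  also note upper
  finally have "c / (real n + 1) \<le> 2 * \<epsilon>"
    using \<epsilon> by (simp add: ennreal_le_iff)
  moreover have "0 < c * (real n + 1)" using c by (simp add: add_nonneg_pos)
  ultimately show False by (simp add: \<epsilon>_def field_simps)
qed

lemma AE_invariant_diag_pos:
  fixes A :: "(real \<times> (real \<times> (real ^ 'd))) set" and \<beta> :: "real ^ 'd"
  assumes \<alpha>: "\<alpha> \<notin> \<rat>" and A: "A \<in> sets (borel \<Otimes>\<^sub>M borel)" and t: "0 < t"
    and inv: "AE x in circle. \<forall>w. (rotation \<alpha> x, w + sawtooth_cocycle \<beta> x) \<in> A \<longleftrightarrow> (x, w) \<in> A"
  shows "AE x in circle. AE w in lborel. (x, w + diag t) \<in> A \<longleftrightarrow> (x, w) \<in> A"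
proof -
  define E where "E t = {x\<in>{0..<1}. \<exists>n. defect A (diag t) n x \<noteq> 0}" for t
  have E_iff: "x \<in> E t \<longleftrightarrow> x \<in> {0..<1} \<and> \<not> (AE w in lborel. (x, w + diag t) \<in> A \<longleftrightarrow> (x, w) \<in> A)" for x t
    by (simp add: E_def AE_eq_translate_iff_defect[OF A])
  have [measurable]: "defect A (diag t) n \<in> borel_measurable borel" for t n
    by (rule measurable_defect[OF A])
  have E: "E t \<in> sets circle" for t
    by (auto simp: E_def sets_circle_iff)
  \<comment> \<open>If the translation by diag (t/m) is harmless up to a null set of w, so is its
    m-fold composition, the translation by diag t.\<close>
  have mono: "E t \<subseteq> E (t / real m)" if m: "0 < m" for m :: nat
  proof
    fix x assume x: "x \<in> E t"
    show "x \<in> E (t / real m)"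
    proof (rule ccontr)
      assume "x \<notin> E (t / real m)"
      then have *: "AE w in lborel. (x, w + diag (t / real m)) \<in> A \<longleftrightarrow> (x, w) \<in> A"
        using x by (simp add: E_iff)
      have "AE w in lborel. (x, w + diag (real k * (t / real m))) \<in> A \<longleftrightarrow> (x, w) \<in> A" for k
      proof (induction k)
        case (Suc k)
        from AE_lborel_translate[OF *, of "diag (real k * (t / real m))"] Suc
        show ?case
        proof eventually_elim
          case (elim w)
          have "w + diag (real (Suc k) * (t / real m))
              = w + diag (real k * (t / real m)) + diag (t / real m)"
            by (simp only: of_nat_Suc distrib_right diag_add mult_1 add_ac)
          then show ?case using elim by (simp only:)
        qed
      qed simp
      from this[of m] have "x \<notin> E t" using m by (simp add: E_iff)
      then show False using x by simp
    qed
  qed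
  have "emeasure circle (E t) \<le> ennreal (real (CARD('d) + 1) * (t / real (Suc m)))" for m
  proof -
    have "emeasure circle (E t) \<le> emeasure circle (E (t / real (Suc m)))"
      by (rule emeasure_mono[OF mono E]) simp
    also have "\<dots> \<le> ennreal (real (CARD('d) + 1) * (t / real (Suc m)))"
      unfolding E_def by (rule emeasure_defect_le[OF \<alpha> A _ inv]) (use t in simp)
    finally show ?thesis .
  qed
  moreover have "(\<lambda>m. ennreal (real (CARD('d) + 1) * (t / real (Suc m)))) \<longlonglongrightarrow> ennreal (real (CARD('d) + 1) * 0)"
    by (intro tendsto_ennrealI tendsto_mult tendsto_const LIMSEQ_Suc lim_const_over_n)
  ultimately have "emeasure circle (E t) \<le> ennreal (real (CARD('d) + 1) * 0)"
    by (intro LIMSEQ_le_const[of _ _ "emeasure circle (E t)"]) auto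
  then have "emeasure circle (E t) = 0" by simp
  then show ?thesis
    using E[of t] by (intro AE_I[of _ _ "E t"]) (auto simp: E_iff)
qed

proposition AE_invariant_diag:
  fixes A :: "(real \<times> (real \<times> (real ^ 'd))) set" and \<beta> :: "real ^ 'd"
  assumes \<alpha>: "\<alpha> \<notin> \<rat>" and A: "A \<in> sets (borel \<Otimes>\<^sub>M borel)"
    and inv: "AE x in circle. \<forall>w. (rotation \<alpha> x, w + sawtooth_cocycle \<beta> x) \<in> A \<longleftrightarrow> (x, w) \<in> A"
  shows "AE x in circle. AE w in lborel. (x, w + diag t) \<in> A \<longleftrightarrow> (x, w) \<in> A"
proof -
  consider "0 < t" | "t = 0" | "0 < - t" by linarith
  then show ?thesis
  proof cases
    case 1
    then show ?thesis by (rule AE_invariant_diag_pos[OF \<alpha> A _ inv])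
  next
    case 3
    from AE_invariant_diag_pos[OF \<alpha> A 3 inv] show ?thesis
    proof eventually_elim
      case (elim x)
      from AE_lborel_translate[OF elim, of "diag t"] show ?case
        by eventually_elim (simp add: diag_minus)
    qed
  qed simp
qed

section \<open>From the sawtooth cocycle to the step cocycle\<close>

lemma closed_subgroup_add_iff:
  assumes "closed_subgroup H" "h \<in> H"
  shows "x + h \<in> H \<longleftrightarrow> x \<in> H"
  using closed_subgroupD(3)[OF assms(1) _ assms(2), of x]
    closed_subgroupD(5)[OF assms(1) _ assms(2), of "x + h"] by auto

lemma infdist_add_subgroup:
  assumes H: "closed_subgroup H" and h: "h \<in> H"
  shows "infdist (x + h) H = infdist x H"
proof -
  have "infdist (x + k) H \<le> infdist x H" if k: "k \<in> H" for x k
  proof -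
    have ne: "H \<noteq> {}" using k by auto
    obtain a where a: "a \<in> H" "infdist x H = dist x a"
      using infdist_attains_inf[OF closed_subgroupD(1)[OF H] ne] by blast
    have "infdist (x + k) H \<le> dist (x + k) (a + k)"
      by (rule infdist_le) (use H a k closed_subgroupD in blast)
    also have "\<dots> = dist x a" by simp
    finally show ?thesis using a by simp
  qed
  from this[OF h, of x] this[OF closed_subgroupD(4)[OF H h], of "x + h"]
  show ?thesis by simp
qed

lemma AE_circle_ex:
  assumes "AE x in circle. P x"
  shows "\<exists>x\<in>{0..<1}. P x"
proof (rule ccontr)
  assume none: "\<not> (\<exists>x\<in>{0..<1}. P x)"
  from assms AE_space have "AE x in circle. False"
    by eventually_elim (use none in auto)
  then have "emeasure circle (space circle) = 0" using AE_E2[of "\<lambda>_. False" circle] by (simp del: space_circle)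
  then show False using emeasure_space_circle by simp
qed

text \<open>With f the transfer function, w + f(x) changes along the skew product by \<Psi>(x), an
  element of H. Its distance to H is therefore invariant, and so is the tube where this distance is
  below r. The tube must be invariant under the diagonal, which is impossible if diag t is off H and
  r is small.\<close>

lemma diag_mem_of_cohomologous:
  fixes \<beta> :: "real ^ 'd"
  assumes \<alpha>: "\<alpha> \<notin> \<rat>" and H: "closed_subgroup H"
    and coh: "cohomologous (rotation \<alpha>) (sawtooth_cocycle \<beta>) \<Psi>" and \<Psi>: "\<forall>x\<in>{0..<1}. \<Psi> x \<in> H"
  shows "diag t \<in> H"
proof (rule ccontr)
  assume t: "diag t \<notin> H"
  obtain f where f: "f \<in> borel_measurable circle"
    and eq: "AE x in circle. sawtooth_cocycle \<beta> x - \<Psi> x = f x - f (rotation \<alpha> x)"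
    using coh unfolding cohomologous_def by blast
  define g where "g x = f (frac x)" for x
  have g [measurable]: "g \<in> borel_measurable borel"
    unfolding g_def by (rule measurable_compose[OF _ f]) measurable
  \<comment> \<open>Half the distance: the r-ball around 0 is within r of H, while its translate by
    diag t stays farther than r from H.\<close>
  define r where "r = infdist (diag t) H / 2"
  have "0 < infdist (diag t) H"
    using t closed_subgroupD(1,2)[OF H] infdist_pos_not_in_closed by blast
  then have r: "0 < r" by (simp add: r_def)
  define A where "A = {z \<in> space (borel \<Otimes>\<^sub>M borel). infdist (snd z + g (fst z)) H < r}"
  have [measurable]: "(\<lambda>w. infdist w H) \<in> borel_measurable borel"
    by (intro borel_measurable_continuous_onI continuous_intros)
  have A: "A \<in> sets (borel \<Otimes>\<^sub>M borel)" unfolding A_def by measurable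
  have A_iff: "(x, w) \<in> A \<longleftrightarrow> infdist (w + g x) H < r" for x w
    by (simp add: A_def space_pair_measure)
  have "AE x in circle. \<forall>w. (rotation \<alpha> x, w + sawtooth_cocycle \<beta> x) \<in> A \<longleftrightarrow> (x, w) \<in> A"
    using eq AE_space
  proof eventually_elim
    case (elim x)
    show ?case
    proof
      fix w
      have "g x = f x" "g (rotation \<alpha> x) = f (rotation \<alpha> x)"
        using elim(2) by (simp_all add: g_def rotation_def)
      then have "w + sawtooth_cocycle \<beta> x + g (rotation \<alpha> x) = (w + g x) + \<Psi> x"
        using elim(1) by (simp add: algebra_simps)
      then show "(rotation \<alpha> x, w + sawtooth_cocycle \<beta> x) \<in> A \<longleftrightarrow> (x, w) \<in> A"
        using infdist_add_subgroup[OF H, of "\<Psi> x" "w + g x"] \<Psi> elim(2) by (simp only: A_iff space_circle)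
    qed
  qed
  from AE_circle_ex[OF AE_invariant_diag[OF \<alpha> A this, of t]]
  obtain x where "AE w in lborel. (x, w + diag t) \<in> A \<longleftrightarrow> (x, w) \<in> A" by blast
  from AE_lborel_translate[OF this, of "- g x"]
  have "AE w in lborel. w \<notin> ball (0 :: real \<times> (real ^ 'd)) r"
  proof eventually_elim
    case (elim w)
    have *: "infdist (w + diag t) H < r \<longleftrightarrow> infdist w H < r"
      using elim by (simp add: A_iff algebra_simps)
    show ?case
    proof
      assume "w \<in> ball 0 r"
      then have w: "norm w < r" by simp
      have "infdist w H < r"
        using infdist_le[OF closed_subgroupD(2)[OF H], of w] w by simp
      moreover have "infdist (diag t) H \<le> infdist (w + diag t) H + dist (diag t) (w + diag t)"
        by (rule infdist_triangle)
      moreover have "dist (diag t) (w + diag t) = norm w" by (simp add: dist_norm)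
      ultimately show False using * w by (simp add: r_def)
    qed
  qed
  then have "ball 0 r \<in> null_sets (lborel :: (real \<times> (real ^ 'd)) measure)"
    by (subst AE_iff_null_sets) auto
  then have "negligible (ball (0 :: real \<times> (real ^ 'd)) r)"
    by (simp add: negligible_iff_null_sets null_sets_completionI)
  then show False using open_not_negligible[OF open_ball, of 0 r] r by fastforce
qed

section \<open>The quotient of a closed subgroup by the diagonal, with its Haar measure\<close>

lemma haar_measure_onI:
  assumes H: "closed_subgroup H" and sets: "sets \<eta> = sets (restrict_space borel H)"
    and "emeasure \<eta> H \<noteq> 0" "\<And>K. compact K \<Longrightarrow> K \<subseteq> H \<Longrightarrow> emeasure \<eta> K < \<infinity>"
    and inv: "\<And>h B. h \<in> H \<Longrightarrow> B \<in> sets \<eta> \<Longrightarrow> emeasure \<eta> {x\<in>H. x + h \<in> B} = emeasure \<eta> B"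
  shows "haar_measure_on H \<eta>"
proof -
  have "emeasure \<eta> ((+) h ` B) = emeasure \<eta> B" if h: "h \<in> H" and B: "B \<in> sets \<eta>" for h B
  proof -
    have "B \<subseteq> H" using sets.sets_into_space[OF B] sets_eq_imp_space_eq[OF sets]
      by (simp add: space_restrict_space)
    have "(+) h ` B = {x\<in>H. x + (- h) \<in> B}"
    proof (intro equalityI subsetI)
      fix x assume "x \<in> (+) h ` B"
      then obtain b where "b \<in> B" "x = h + b" by blast
      then show "x \<in> {x\<in>H. x + (- h) \<in> B}"
        using \<open>B \<subseteq> H\<close> closed_subgroupD(3)[OF H h] by auto
    next
      fix x assume "x \<in> {x\<in>H. x + (- h) \<in> B}"
      then show "x \<in> (+) h ` B" by (intro image_eqI[of _ _ "x + (- h)"]) auto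
    qed
    then show ?thesis using inv[OF closed_subgroupD(4)[OF H h] B] by simp
  qed
  then show ?thesis using assms by (simp add: haar_measure_on_def)
qed

text \<open>A linear model of the projection modulo the diagonal: the kernel is the range of
  \<open>diag\<close>, and on [0,1) it takes the sawtooth cocycle to the step cocycle when all
  shifts lie in [0,1).\<close>

definition shear :: "real \<times> (real ^ 'd) \<Rightarrow> real ^ 'd" where
  "shear w = snd w - vec (fst w)"

lemma measurable_shear: "(shear :: real \<times> (real ^ 'd) \<Rightarrow> _) \<in> borel_measurable borel"
  unfolding borel_prod[symmetric] shear_def[abs_def] by measurable

lemma shear_add: "shear (v + w) = shear v + shear w"
  by (simp add: shear_def vec_add)

lemma shear_diff: "shear (v - w) = shear v - shear w"
  by (simp add: shear_def vec_sub)

lemma shear_eq: "(0, shear w) = w - diag (fst w)"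
  by (cases w) (simp add: shear_def diag_def)

text \<open>As H contains the diagonal, it is the direct sum of the diagonal and its slice with
  first coordinate 0, and \<open>shear\<close> is the projection to that slice. Being linear, it
  carries the cohomology equation along, and sets invariant downstairs have invariant preimages
  upstairs.\<close>

theorem regular_step_cocycle:
  fixes \<beta> :: "real ^ 'd"
  assumes \<alpha>: "\<alpha> \<notin> \<rat>" and \<beta>: "\<And>j. 0 \<le> \<beta> $ j \<and> \<beta> $ j < 1"
    and reg: "regular_cocycle (rotation \<alpha>) (sawtooth_cocycle \<beta>)"
  shows "regular_cocycle (rotation \<alpha>) (step_cocycle \<beta>)"
proof -
  obtain \<Psi> H \<eta> where \<Psi>: "cocycle \<Psi>" and coh: "cohomologous (rotation \<alpha>) (sawtooth_cocycle \<beta>) \<Psi>"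
    and H: "closed_subgroup H" and \<Psi>H: "\<forall>x\<in>{0..<1}. \<Psi> x \<in> H" and \<eta>: "haar_measure_on H \<eta>"
    and erg: "ergodic (circle \<Otimes>\<^sub>M \<eta>) (skew_product (rotation \<alpha>) \<Psi>)"
    using reg unfolding regular_cocycle_def by blast
  have cl: "closed H" using H by (rule closed_subgroupD)
  interpret \<eta>: sigma_finite_measure \<eta> by (rule haar_sigma_finite[OF cl \<eta>])
  note [simp] = haar_space[OF \<eta>]
  have diag: "diag t \<in> H" for t by (rule diag_mem_of_cohomologous[OF \<alpha> H coh \<Psi>H])
  define H' where "H' = {z. (0, z) \<in> H}"
  have shear_H': "shear w \<in> H'" if "w \<in> H" for w
    using closed_subgroupD(5)[OF H that diag] by (simp add: H'_def shear_eq)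
  have "closed ((\<lambda>z. (0, z)) -` H)"
    by (intro closed_vimage cl continuous_intros)
  moreover have "(\<lambda>z. (0, z)) -` H = H'" by (auto simp: H'_def)
  ultimately have cl': "closed H'" by simp
  have H': "closed_subgroup H'"
    unfolding closed_subgroup_def
  proof (intro conjI ballI cl')
    show "0 \<in> H'" using closed_subgroupD(2)[OF H] by (simp add: H'_def zero_prod_def)
    show "x + y \<in> H'" if "x \<in> H'" "y \<in> H'" for x y
      using closed_subgroupD(3)[OF H, of "(0, x)" "(0, y)"] that by (simp add: H'_def)
    show "- x \<in> H'" if "x \<in> H'" for x
      using closed_subgroupD(4)[OF H, of "(0, x)"] that by (simp add: H'_def)
  qed
  define \<Psi>' where "\<Psi>' x = shear (\<Psi> x)" for x
  have sh [measurable]: "shear \<in> borel_measurable borel"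
    by (rule measurable_shear)
  have \<Psi>': "cocycle \<Psi>'"
    using measurable_compose[OF \<Psi>[unfolded cocycle_def] sh] by (simp add: cocycle_def \<Psi>'_def[abs_def])
  have \<Psi>'H': "\<forall>x\<in>{0..<1}. \<Psi>' x \<in> H'" using \<Psi>H shear_H' by (simp add: \<Psi>'_def)
  have coh': "cohomologous (rotation \<alpha>) (step_cocycle \<beta>) \<Psi>'"
  proof -
    obtain f where f: "f \<in> borel_measurable circle"
      and eq: "AE x in circle. sawtooth_cocycle \<beta> x - \<Psi> x = f x - f (rotation \<alpha> x)"
      using coh unfolding cohomologous_def by blast
    have "AE x in circle. step_cocycle \<beta> x - \<Psi>' x = shear (f x) - shear (f (rotation \<alpha> x))"
      using eq AE_space
    proof eventually_elim
      case (elim x)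
      have "shear (sawtooth_cocycle \<beta> x) = step_cocycle \<beta> x"
        using sawtooth_cocycle_eq[of \<beta> x] \<beta> elim(2) by (simp add: shear_def diag_def)
      then show ?case
        using arg_cong[OF elim(1), of shear] by (simp add: shear_diff \<Psi>'_def)
    qed
    moreover have "(\<lambda>x. shear (f x)) \<in> borel_measurable circle"
      by (rule measurable_compose[OF f sh])
    ultimately show ?thesis
      unfolding cohomologous_def by (intro bexI[of _ "\<lambda>x. shear (f x)"])
  qed
  \<comment> \<open>The image of \<eta> itself would only take the values 0 and infinity, as the
    fibres of \<open>shear\<close> are whole lines. The slab cuts each fibre to a unit segment; its
    integer translates along the diagonal cover H, so it is not null.\<close>
  define \<Omega> where "\<Omega> = {w \<in> H. fst w \<in> {0..<1}}"
  define \<eta>' where "\<eta>' = distr (restrict_space \<eta> \<Omega>) (restrict_space borel H') shear"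
  have fst_m: "fst \<in> borel_measurable \<eta>"
  proof -
    have "fst \<in> borel_measurable (borel :: (real \<times> (real ^ 'd)) measure)"
      unfolding borel_prod[symmetric] by measurable
    from measurable_compose[OF measurable_haar_id[OF \<eta>] this] show ?thesis .
  qed
  have \<Omega>: "\<Omega> \<in> sets \<eta>"
  proof -
    have "fst -` {0..<1} \<inter> space \<eta> \<in> sets \<eta>" by (rule measurable_sets[OF fst_m]) simp
    moreover have "fst -` {0..<1} \<inter> space \<eta> = \<Omega>" by (auto simp: \<Omega>_def)
    ultimately show ?thesis by simp
  qed
  have sets': "sets \<eta>' = sets (restrict_space borel H')" by (simp add: \<eta>'_def)
  have sh_\<eta>: "shear \<in> measurable \<eta> (restrict_space borel H')"
    using measurable_compose[OF measurable_haar_id[OF \<eta>] sh] shear_H'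
    by (intro measurable_restrict_space2) auto
  have em': "emeasure \<eta>' B = emeasure \<eta> {w \<in> \<Omega>. shear w \<in> B}"
    and em_sets: "{w \<in> \<Omega>. shear w \<in> B} \<in> sets \<eta>" if B: "B \<in> sets \<eta>'" for B
  proof -
    have B': "B \<in> sets (restrict_space borel H')" using B sets' by simp
    have sp: "space (restrict_space \<eta> \<Omega>) = \<Omega>" by (auto simp: space_restrict_space \<Omega>_def)
    have eq: "shear -` B \<inter> space (restrict_space \<eta> \<Omega>) = {w \<in> \<Omega>. shear w \<in> B}"
      unfolding sp by auto
    have m: "shear \<in> measurable (restrict_space \<eta> \<Omega>) (restrict_space borel H')"
      by (rule measurable_restrict_space1[OF sh_\<eta>])
    have "emeasure \<eta>' B = emeasure (restrict_space \<eta> \<Omega>) {w \<in> \<Omega>. shear w \<in> B}"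
      unfolding \<eta>'_def using emeasure_distr[OF m B'] by (simp only: eq)
    also have "\<dots> = emeasure \<eta> {w \<in> \<Omega>. shear w \<in> B}"
      using \<Omega> by (intro emeasure_restrict_space) (auto intro: sets.Int simp del: haar_space[OF \<eta>])
    finally show "emeasure \<eta>' B = emeasure \<eta> {w \<in> \<Omega>. shear w \<in> B}" .
    have "shear -` B \<inter> space \<eta> \<inter> \<Omega> \<in> sets \<eta>"
      using measurable_sets[OF sh_\<eta> B'] \<Omega> by auto
    moreover have "shear -` B \<inter> space \<eta> \<inter> \<Omega> = {w \<in> \<Omega>. shear w \<in> B}" by (auto simp: \<Omega>_def)
    ultimately show "{w \<in> \<Omega>. shear w \<in> B} \<in> sets \<eta>" by simp
  qed
  have \<eta>': "haar_measure_on H' \<eta>'"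
  proof (rule haar_measure_onI[OF H' sets'])
    have H'_sets: "H' \<in> sets \<eta>'"
      unfolding sets' using cl' by (simp add: sets_restrict_space_iff)
    have "{w \<in> \<Omega>. shear w \<in> H'} = \<Omega>" using shear_H' by (auto simp: \<Omega>_def)
    then have em: "emeasure \<eta>' H' = emeasure \<eta> \<Omega>" using em'[OF H'_sets] by simp
    show "emeasure \<eta>' H' \<noteq> 0"
    proof
      assume "emeasure \<eta>' H' = 0"
      then have "emeasure \<eta> \<Omega> = 0" using em by simp
      have "{w\<in>H. w + diag (- of_int n) \<in> \<Omega>} \<in> null_sets \<eta>" for n :: int
      proof -
        have "emeasure \<eta> {w\<in>H. w + diag (- of_int n) \<in> \<Omega>} = 0"
          using haar_vimage_translation[OF H \<eta> diag \<Omega>] \<open>emeasure \<eta> \<Omega> = 0\<close> by simp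
        moreover have "fst -` {of_int n..<of_int n + 1} \<inter> space \<eta> \<in> sets \<eta>"
          by (rule measurable_sets[OF fst_m]) simp
        moreover have "fst -` {of_int n..<of_int n + 1} \<inter> space \<eta> = {w\<in>H. w + diag (- of_int n) \<in> \<Omega>}"
          using closed_subgroup_add_iff[OF H diag]
          by (auto simp: \<Omega>_def) (simp_all add: diag_def)
        ultimately show ?thesis by (auto simp: null_sets_def)
      qed
      then have "(\<Union>n::int. {w\<in>H. w + diag (- of_int n) \<in> \<Omega>}) \<in> null_sets \<eta>"
        by (intro null_sets_UN') auto
      moreover have "(\<Union>n::int. {w\<in>H. w + diag (- of_int n) \<in> \<Omega>}) = H"
      proof (intro equalityI subsetI)
        fix w assume w: "w \<in> H"
        have "w + diag (- of_int \<lfloor>fst w\<rfloor>) \<in> \<Omega>"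
          using w closed_subgroup_add_iff[OF H diag] by (simp add: \<Omega>_def) (simp add: diag_def, linarith)
        then show "w \<in> (\<Union>n::int. {w\<in>H. w + diag (- of_int n) \<in> \<Omega>})" using w by blast
      qed auto
      ultimately show False using \<eta> by (auto simp: haar_measure_on_def null_sets_def)
    qed
  next
    fix K assume K: "compact K" "K \<subseteq> H'"
    \<comment> \<open>A compact part of H that contains everything in the slab lying over K.\<close>
    let ?C = "(\<lambda>(y, z). (y, z + vec y)) ` ({0..1} \<times> K)"
    have "continuous_on ({0..1} \<times> K) (\<lambda>(y, z). (y, z + vec y))"
      unfolding case_prod_beta
      by (intro continuous_intros continuous_on_compose2[OF continuous_on_vec[of UNIV]]) auto
    then have C: "compact ?C" by (rule compact_continuous_image) (intro compact_Times K compact_Icc)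
    have "?C \<subseteq> H"
    proof
      fix w assume "w \<in> ?C"
      then obtain y z where z: "z \<in> K" "w = (0, z) + diag y" by (auto simp: diag_def)
      then have "(0, z) \<in> H" using K by (auto simp: H'_def)
      then show "w \<in> H" using closed_subgroupD(3)[OF H _ diag] z by simp
    qed
    then have "emeasure \<eta> ?C < \<infinity>" using \<eta> C by (auto simp: haar_measure_on_def)
    moreover have "?C \<in> sets \<eta>"
      using haar_sets_iff[OF cl \<eta>] C \<open>?C \<subseteq> H\<close> by (auto intro: borel_closed compact_imp_closed)
    moreover have "{w \<in> \<Omega>. shear w \<in> K} \<subseteq> ?C"
    proof
      fix w assume "w \<in> {w \<in> \<Omega>. shear w \<in> K}"
      then show "w \<in> ?C"
        by (intro image_eqI[of _ _ "(fst w, shear w)"]) (auto simp: \<Omega>_def shear_def)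
    qed
    moreover have "K \<in> sets \<eta>'"
      unfolding sets' using K cl' by (auto simp: sets_restrict_space_iff intro: borel_closed compact_imp_closed)
    ultimately show "emeasure \<eta>' K < \<infinity>"
      using em'[of K] emeasure_mono[of "{w \<in> \<Omega>. shear w \<in> K}" ?C \<eta>] by auto
  next
    fix h B assume h: "h \<in> H'" and B: "B \<in> sets \<eta>'"
    have h0: "(0, h) \<in> H" using h by (simp add: H'_def)
    have B': "B \<in> sets borel" "B \<subseteq> H'"
      using B unfolding sets' using cl' by (auto simp: sets_restrict_space_iff)
    have "{x \<in> H'. x + h \<in> B} = (\<lambda>x. x + h) -` B \<inter> H'" by auto
    moreover have "(\<lambda>x. x + h) -` B \<in> sets borel"
      using measurable_sets_borel[of "\<lambda>x. x + h" borel B] B'(1) by simp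
    ultimately have "{x \<in> H'. x + h \<in> B} \<in> sets \<eta>'"
      unfolding sets' using cl' by (auto simp: sets_restrict_space_iff)
    then have "emeasure \<eta>' {x \<in> H'. x + h \<in> B} = emeasure \<eta> {w \<in> \<Omega>. shear w \<in> {x \<in> H'. x + h \<in> B}}"
      by (rule em')
    \<comment> \<open>Translation by (0, h) leaves the first coordinate alone and so preserves the
      slab.\<close>
    also have "{w \<in> \<Omega>. shear w \<in> {x \<in> H'. x + h \<in> B}} = {w \<in> H. w + (0, h) \<in> {w \<in> \<Omega>. shear w \<in> B}}"
      using closed_subgroup_add_iff[OF H h0] shear_H'
      by (auto simp: \<Omega>_def shear_def algebra_simps)
    also have "emeasure \<eta> \<dots> = emeasure \<eta> {w \<in> \<Omega>. shear w \<in> B}"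
      by (rule haar_vimage_translation[OF H \<eta> h0 em_sets[OF B]])
    also have "\<dots> = emeasure \<eta>' B" by (rule em'[OF B, symmetric])
    finally show "emeasure \<eta>' {x \<in> H'. x + h \<in> B} = emeasure \<eta>' B" .
  qed
  interpret \<eta>': sigma_finite_measure \<eta>' by (rule haar_sigma_finite[OF cl' \<eta>'])
  note [simp] = haar_space[OF \<eta>']
  let ?M = "circle \<Otimes>\<^sub>M \<eta>" and ?M' = "circle \<Otimes>\<^sub>M \<eta>'"
  let ?S = "skew_product (rotation \<alpha>) \<Psi>" and ?S' = "skew_product (rotation \<alpha>) \<Psi>'"
  let ?G = "\<lambda>z. (fst z, shear (snd z))"
  have G: "?G \<in> measurable ?M ?M'"
  proof (rule measurable_Pair[OF measurable_fst])
    have "shear \<in> measurable \<eta> \<eta>'" using sh_\<eta> measurable_cong_sets[OF refl sets'] by blast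
    from measurable_compose[OF measurable_snd this] show "(\<lambda>z. shear (snd z)) \<in> measurable ?M \<eta>'" .
  qed
  \<comment> \<open>An inequality is enough: it turns a null preimage in \<open>?M\<close> into a
    null set of \<open>?M'\<close>.\<close>
  have le: "emeasure ?M' A \<le> emeasure ?M (?G -` A \<inter> space ?M)" if A: "A \<in> sets ?M'" for A
  proof -
    have "emeasure ?M' A = (\<integral>\<^sup>+x. emeasure \<eta>' (Pair x -` A) \<partial>circle)"
      by (rule \<eta>'.emeasure_pair_measure_alt[OF A])
    also have "\<dots> \<le> (\<integral>\<^sup>+x. emeasure \<eta> (Pair x -` (?G -` A \<inter> space ?M)) \<partial>circle)"
    proof (rule nn_integral_mono)
      fix x assume x: "x \<in> space circle"
      have "emeasure \<eta>' (Pair x -` A) = emeasure \<eta> {w \<in> \<Omega>. shear w \<in> Pair x -` A}"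
        by (rule em'[OF sets_Pair1[OF A]])
      also have "\<dots> \<le> emeasure \<eta> (Pair x -` (?G -` A \<inter> space ?M))"
        by (rule emeasure_mono[OF _ sets_Pair1[OF measurable_sets[OF G A]]])
          (use x in \<open>auto simp: \<Omega>_def space_pair_measure\<close>)
      finally show "emeasure \<eta>' (Pair x -` A) \<le> emeasure \<eta> (Pair x -` (?G -` A \<inter> space ?M))" .
    qed
    also have "\<dots> = emeasure ?M (?G -` A \<inter> space ?M)"
      by (rule \<eta>.emeasure_pair_measure_alt[OF measurable_sets[OF G A], symmetric])
    finally show ?thesis .
  qed
  have "ergodic ?M' ?S'"
    unfolding ergodic_def
  proof (intro conjI ballI impI)
    show "?S' \<in> measurable ?M' ?M'" by (rule skew_product_measurable[OF H' \<eta>' \<Psi>' \<Psi>'H'])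
    show "distr ?M' ?M' ?S' = ?M'" by (rule distr_skew_product[OF H' \<eta>' \<Psi>' \<Psi>'H'])
    fix A assume A: "A \<in> sets ?M'" and inv: "?S' -` A \<inter> space ?M' = A"
    let ?A = "?G -` A \<inter> space ?M"
    have "?S -` ?A \<inter> space ?M = ?A"
    proof (rule set_eqI)
      fix z
      show "z \<in> ?S -` ?A \<inter> space ?M \<longleftrightarrow> z \<in> ?A"
      proof (cases "z \<in> space ?M")
        case True
        then obtain x w where z: "z = (x, w)" "x \<in> {0..<1}" "w \<in> H" by (auto simp: space_pair_measure)
        have "(x, shear w) \<in> space ?M'" using z shear_H' by (simp add: space_pair_measure)
        then have "(x, shear w) \<in> A \<longleftrightarrow> ?S' (x, shear w) \<in> A" using inv by blast
        moreover have "w + \<Psi> x \<in> H" using z \<Psi>H closed_subgroupD(3)[OF H] by simp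
        ultimately show ?thesis using z
          by (simp add: skew_product_def space_pair_measure shear_add \<Psi>'_def)
      qed simp
    qed
    then have "emeasure ?M ?A = 0 \<or> emeasure ?M (space ?M - ?A) = 0"
      using erg measurable_sets[OF G A] unfolding ergodic_def by blast
    moreover have "space ?M - ?A = ?G -` (space ?M' - A) \<inter> space ?M"
      using measurable_space[OF G] by auto
    ultimately show "emeasure ?M' A = 0 \<or> emeasure ?M' (space ?M' - A) = 0"
      using le[OF A] le[OF sets.compl_sets[OF A]] by auto
  qed
  moreover have "cocycle (step_cocycle \<beta>)"
    unfolding cocycle_def by (rule measurable_circle_restrict[OF measurable_step_cocycle])
  ultimately show ?thesis
    unfolding regular_cocycle_def using \<Psi>' coh' H' \<Psi>'H' \<eta>' by blast
qed

section \<open>An equivariant Borel projection onto a closed subgroup\<close>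

text \<open>Nearest points of H need not be unique, so whole compact sets of candidates are carried
  along until repeated minimization leaves one point. The last clause is measurability of a
  set-valued map; for singletons it says that the selected point is a Borel function of z.\<close>

definition equivariant_selection :: "'a::euclidean_space set \<Rightarrow> ('a \<Rightarrow> 'a set) \<Rightarrow> bool" where
  "equivariant_selection H C \<longleftrightarrow>
     (\<forall>z. compact (C z) \<and> C z \<noteq> {} \<and> C z \<subseteq> H) \<and>
     (\<forall>z. \<forall>h\<in>H. \<forall>x. x + h \<in> C (z + h) \<longleftrightarrow> x \<in> C z) \<and>
     (\<forall>K. closed K \<longrightarrow> {z. C z \<inter> K \<noteq> {}} \<in> sets borel)"

text \<open>The distance to H is unchanged by translations in H, which gives equivariance. Some
  nearest point lies in K precisely when H and H \<inter> K are equally far from z, and this is a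
  closed condition on z.\<close>

lemma equivariant_selection_nearest:
  assumes H: "closed_subgroup H"
  shows "equivariant_selection H (\<lambda>z. {x\<in>H. dist z x = infdist z H})"
  unfolding equivariant_selection_def
proof (intro conjI allI ballI impI)
  fix z
  have ne: "H \<noteq> {}" and cl: "closed H" using closed_subgroupD(1,2)[OF H] by auto
  have "closed (H \<inter> {x. dist z x = infdist z H})"
    by (intro closed_Int cl closed_Collect_eq continuous_intros)
  moreover have "{x\<in>H. dist z x = infdist z H} \<subseteq> cball z (infdist z H)" by auto
  ultimately show "compact {x\<in>H. dist z x = infdist z H}"
    unfolding compact_eq_bounded_closed by (auto simp: Int_def intro: bounded_subset[OF bounded_cball])
  show "{x\<in>H. dist z x = infdist z H} \<noteq> {}"
  proof -
    obtain x where "x \<in> H" "infdist z H = dist z x"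
      using infdist_attains_inf[OF cl ne] by blast
    then show ?thesis by auto
  qed
next
  fix z h x assume h: "h \<in> H"
  show "x + h \<in> {x\<in>H. dist (z + h) x = infdist (z + h) H} \<longleftrightarrow> x \<in> {x\<in>H. dist z x = infdist z H}"
    using h by (simp add: closed_subgroup_add_iff[OF H] infdist_add_subgroup[OF H])
next
  fix K :: "'a set" assume K: "closed K"
  have cl: "closed H" using closed_subgroupD(1)[OF H] .
  show "{z. {x\<in>H. dist z x = infdist z H} \<inter> K \<noteq> {}} \<in> sets borel"
  \<comment> \<open>\<open>infdist\<close> to the empty set is 0 by convention, so this case is kept
    apart.\<close>
  proof (cases "H \<inter> K = {}")
    case False
    have "{z. {x\<in>H. dist z x = infdist z H} \<inter> K \<noteq> {}} = {z. infdist z (H \<inter> K) = infdist z H}"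
    proof (intro equalityI subsetI)
      fix z assume "z \<in> {z. {x\<in>H. dist z x = infdist z H} \<inter> K \<noteq> {}}"
      then obtain x where x: "x \<in> H \<inter> K" "dist z x = infdist z H" by auto
      have "infdist z (H \<inter> K) \<le> infdist z H" using infdist_le[OF x(1), of z] x(2) by simp
      moreover have "infdist z H \<le> infdist z (H \<inter> K)" by (rule infdist_mono) (use False in auto)
      ultimately show "z \<in> {z. infdist z (H \<inter> K) = infdist z H}" by simp
    next
      fix z assume z: "z \<in> {z. infdist z (H \<inter> K) = infdist z H}"
      obtain x where "x \<in> H \<inter> K" "infdist z (H \<inter> K) = dist z x"
        using infdist_attains_inf[OF closed_Int[OF cl K] False] by blast
      then show "z \<in> {z. {x\<in>H. dist z x = infdist z H} \<inter> K \<noteq> {}}" using z by auto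
    qed
    also have "closed \<dots>" by (intro closed_Collect_eq continuous_intros)
    finally show ?thesis by (simp add: borel_closed)
  next
    case True
    then have "{z. {x\<in>H. dist z x = infdist z H} \<inter> K \<noteq> {}} = {}" by auto
    then show ?thesis by simp
  qed
qed auto

text \<open>A translation by h changes the functional by the constant h \<bullet> b, so minimizers
  move along with it. Hitting K means that the minimum over C z is attained in K, which can be
  tested at countably many levels.\<close>

lemma equivariant_selection_minimize:
  assumes C: "equivariant_selection H C"
  shows "equivariant_selection H (\<lambda>z. {x\<in>C z. \<forall>y\<in>C z. x \<bullet> b \<le> y \<bullet> b})"
  unfolding equivariant_selection_def
proof (intro conjI allI ballI impI)
  have comp: "compact (C z)" and ne: "C z \<noteq> {}" and sub: "C z \<subseteq> H" for z
    using C by (auto simp: equivariant_selection_def)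
  have trans: "x + h \<in> C (z + h) \<longleftrightarrow> x \<in> C z" if "h \<in> H" for x z h
    using C that by (simp add: equivariant_selection_def)
  have meas: "{z. C z \<inter> K \<noteq> {}} \<in> sets borel" if "closed K" for K
    using C that by (simp add: equivariant_selection_def)
  have inner_cont: "continuous_on S (\<lambda>x. x \<bullet> b)" for S by (intro continuous_intros)
  fix z
  have "{x\<in>C z. \<forall>y\<in>C z. x \<bullet> b \<le> y \<bullet> b} = C z \<inter> (\<Inter>y\<in>C z. {x. x \<bullet> b \<le> y \<bullet> b})" by auto
  moreover have "closed (\<Inter>y\<in>C z. {x. x \<bullet> b \<le> y \<bullet> b})"
    by (intro closed_INT ballI closed_Collect_le continuous_intros)
  ultimately show "compact {x\<in>C z. \<forall>y\<in>C z. x \<bullet> b \<le> y \<bullet> b}"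
    using compact_Int_closed[OF comp] by simp
  show "{x\<in>C z. \<forall>y\<in>C z. x \<bullet> b \<le> y \<bullet> b} \<noteq> {}"
    using continuous_attains_inf[OF comp ne inner_cont, of z] by auto
  show "{x\<in>C z. \<forall>y\<in>C z. x \<bullet> b \<le> y \<bullet> b} \<subseteq> H" using sub by auto
  show "x + h \<in> {x\<in>C (z + h). \<forall>y\<in>C (z + h). x \<bullet> b \<le> y \<bullet> b} \<longleftrightarrow>
      x \<in> {x\<in>C z. \<forall>y\<in>C z. x \<bullet> b \<le> y \<bullet> b}" if h: "h \<in> H" for h x
  proof -
    have "(\<forall>y\<in>C (z + h). (x + h) \<bullet> b \<le> y \<bullet> b) \<longleftrightarrow> (\<forall>y\<in>C z. x \<bullet> b \<le> y \<bullet> b)"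
    proof (intro iffI ballI)
      fix y assume "\<forall>y\<in>C (z + h). (x + h) \<bullet> b \<le> y \<bullet> b" "y \<in> C z"
      then have "(x + h) \<bullet> b \<le> (y + h) \<bullet> b" using trans[OF h] by blast
      then show "x \<bullet> b \<le> y \<bullet> b" by (simp add: inner_add_left)
    next
      fix y assume a: "\<forall>y\<in>C z. x \<bullet> b \<le> y \<bullet> b" "y \<in> C (z + h)"
      then have "y - h \<in> C z" using trans[OF h, of "y - h" z] by simp
      then have "x \<bullet> b \<le> (y - h) \<bullet> b" using a by blast
      then show "(x + h) \<bullet> b \<le> y \<bullet> b" by (simp add: inner_add_left inner_diff_left)
    qed
    then show ?thesis using trans[OF h] by simp
  qed
  fix K :: "'a set" assume K: "closed K"
  let ?L = "\<lambda>r::real. {x. x \<bullet> b \<le> r}"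
  have L: "closed (?L r)" for r by (intro closed_Collect_le continuous_intros)
  \<comment> \<open>The right-hand side says, for each rational r: if C z reaches down to level r,
    it does so inside K. As r decreases to the minimum over C z, compactness yields a minimizer in
    K.\<close>
  have "{z. {x\<in>C z. \<forall>y\<in>C z. x \<bullet> b \<le> y \<bullet> b} \<inter> K \<noteq> {}}
      = (\<Inter>r\<in>\<rat>. (- {z. C z \<inter> ?L r \<noteq> {}}) \<union> {z. C z \<inter> (K \<inter> ?L r) \<noteq> {}})" (is "?l = ?r")
  proof (intro equalityI subsetI)
    fix z assume "z \<in> ?l"
    then obtain x where x: "x \<in> C z" "x \<in> K" "\<forall>y\<in>C z. x \<bullet> b \<le> y \<bullet> b" by auto
    show "z \<in> ?r"
    proof (rule INT_I)
      fix r :: real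
      show "z \<in> (- {z. C z \<inter> ?L r \<noteq> {}}) \<union> {z. C z \<inter> (K \<inter> ?L r) \<noteq> {}}"
      proof (cases "C z \<inter> ?L r = {}")
        case False
        then obtain y where "y \<in> C z" "y \<bullet> b \<le> r" by auto
        then have "x \<in> C z \<inter> (K \<inter> ?L r)" using x by force
        then show ?thesis by blast
      qed simp
    qed
  next
    fix z assume z: "z \<in> ?r"
    obtain x0 where x0: "x0 \<in> C z" "\<And>y. y \<in> C z \<Longrightarrow> x0 \<bullet> b \<le> y \<bullet> b"
      using continuous_attains_inf[OF comp ne inner_cont] by blast
    have near: "C z \<inter> (K \<inter> ?L r) \<noteq> {}" if r: "r \<in> \<rat>" "x0 \<bullet> b < r" for r
    proof -
      have "x0 \<in> C z \<inter> ?L r" using x0(1) r by simp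
      then show ?thesis using z r(1) by blast
    qed
    \<comment> \<open>A single level above the minimum shows that C z meets K, so that the
      functional attains a minimum on C z \<inter> K.\<close>
    obtain r0 :: real where r0: "r0 \<in> \<rat>" "x0 \<bullet> b < r0"
      using Rats_dense_in_real[of "x0 \<bullet> b" "x0 \<bullet> b + 1"] less_add_one by blast
    have "C z \<inter> K \<noteq> {}" using near[OF r0] by blast
    from continuous_attains_inf[OF compact_Int_closed[OF comp K] this inner_cont]
    obtain x1 where x1: "x1 \<in> C z \<inter> K" "\<And>y. y \<in> C z \<inter> K \<Longrightarrow> x1 \<bullet> b \<le> y \<bullet> b" by blast
    have "x1 \<bullet> b \<le> x0 \<bullet> b"
    proof (rule ccontr)
      assume "\<not> x1 \<bullet> b \<le> x0 \<bullet> b"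
      then obtain r where r: "r \<in> \<rat>" "x0 \<bullet> b < r" "r < x1 \<bullet> b"
        using Rats_dense_in_real[of "x0 \<bullet> b" "x1 \<bullet> b"] unfolding not_le by blast
      obtain y where "y \<in> C z \<inter> K" "y \<bullet> b \<le> r" using near[OF r(1,2)] by blast
      then show False using x1(2)[of y] r(3) by simp
    qed
    then have "x1 \<in> {x\<in>C z. \<forall>y\<in>C z. x \<bullet> b \<le> y \<bullet> b} \<inter> K"
      using x1(1) x0(2) by force
    then show "z \<in> ?l" by blast
  qed
  also have "\<dots> \<in> sets borel"
  proof (intro sets.countable_INT'' ballI)
    fix r :: real
    have "{z. C z \<inter> ?L r \<noteq> {}} \<in> sets borel" by (rule meas[OF L])
    moreover have "{z. C z \<inter> (K \<inter> ?L r) \<noteq> {}} \<in> sets borel" by (rule meas[OF closed_Int[OF K L]])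
    ultimately show "(- {z. C z \<inter> ?L r \<noteq> {}}) \<union> {z. C z \<inter> (K \<inter> ?L r) \<noteq> {}} \<in> sets borel" by auto
  qed (auto simp: countable_rat)
  finally show "{z. {x\<in>C z. \<forall>y\<in>C z. x \<bullet> b \<le> y \<bullet> b} \<inter> K \<noteq> {}} \<in> sets borel" .
qed

text \<open>The witness sends a point to the lexicographically smallest among the nearest points of \<open>H\<close>;
  both the distance to \<open>H\<close> and the lexicographic order are translation invariant.\<close>

lemma equivariant_borel_projection:
  fixes H :: "'a::euclidean_space set"
  assumes H: "closed_subgroup H"
  obtains p where "p \<in> borel_measurable borel" "\<And>z. p z \<in> H" "\<And>z h. h \<in> H \<Longrightarrow> p (z + h) = p z + h"
proof -
  \<comment> \<open>After minimizing along b the remaining points share their b-coordinate; running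
    through a basis leaves a singleton.\<close>
  have ex: "\<exists>C. equivariant_selection H C \<and> (\<forall>z. \<forall>x\<in>C z. \<forall>y\<in>C z. \<forall>b\<in>set bs. x \<bullet> b = y \<bullet> b)" for bs :: "'a list"
  proof (induction bs)
    case Nil
    then show ?case using equivariant_selection_nearest[OF H] by auto
  next
    case (Cons b bs)
    then obtain C where C: "equivariant_selection H C"
      "\<And>z x y b. x \<in> C z \<Longrightarrow> y \<in> C z \<Longrightarrow> b \<in> set bs \<Longrightarrow> x \<bullet> b = y \<bullet> b" by blast
    show ?case
      by (rule exI[of _ "\<lambda>z. {x\<in>C z. \<forall>y\<in>C z. x \<bullet> b \<le> y \<bullet> b}"])
        (use equivariant_selection_minimize[OF C(1), of b] C(2) in \<open>auto intro: order_antisym\<close>)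
  qed
  obtain bs :: "'a list" where bs: "set bs = Basis"
    using finite_list[OF finite_Basis] by blast
  obtain C where C: "equivariant_selection H C"
    and C': "\<forall>z. \<forall>x\<in>C z. \<forall>y\<in>C z. \<forall>b\<in>Basis. x \<bullet> b = y \<bullet> b"
    using ex[of bs] unfolding bs by blast
  have in_H: "C z \<subseteq> H" and ne: "C z \<noteq> {}" for z
    using C by (simp_all add: equivariant_selection_def)
  have translate: "x + h \<in> C (z + h) \<longleftrightarrow> x \<in> C z" if "h \<in> H" for x z h
    using C that by (simp add: equivariant_selection_def)
  have meas: "{z. C z \<inter> K \<noteq> {}} \<in> sets borel" if "closed K" for K
    using C that by (simp add: equivariant_selection_def)
  define p where "p z = (SOME x. x \<in> C z)" for z
  have p: "p z \<in> C z" for z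
    unfolding p_def by (rule someI_ex) (use ne in blast)
  have unique: "x = p z" if "x \<in> C z" for x z
    by (rule euclidean_eqI) (use C' that p in blast)
  show thesis
  proof (rule that)
    show "p z \<in> H" for z using p in_H by blast
    show "p (z + h) = p z + h" if "h \<in> H" for z h
      by (rule unique[symmetric]) (simp add: translate[OF that] p)
    show "p \<in> borel_measurable borel"
    proof (rule borel_measurableI)
      fix U :: "'a set" assume "open U"
      then have "{z. C z \<inter> (- U) \<noteq> {}} \<in> sets borel"
        by (intro meas) auto
      moreover have "p -` U \<inter> space borel = - {z. C z \<inter> (- U) \<noteq> {}}"
        using p unique by fastforce
      ultimately show "p -` U \<inter> space borel \<in> sets borel" by auto
    qed
  qed
qed

section \<open>From the step cocycle to the sawtooth cocycle\<close>

lemma AE_lborel_ex: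
  assumes "AE y in (lborel :: 'a::euclidean_space measure). P y"
  shows "\<exists>y. P y"
proof (rule ccontr)
  assume none: "\<nexists>y. P y"
  from assms have "AE y in (lborel :: 'a measure). False"
    by eventually_elim (use none in auto)
  then have "emeasure lborel (space (lborel :: 'a measure)) = 0"
    using AE_E2[of "\<lambda>_. False" "lborel :: 'a measure"] by simp
  then show False by simp
qed

text \<open>Fubini for the product of M1 and M2 against M3. It serves to bring the Haar variable
  from the innermost to the outermost place.\<close>

lemma AE_commute3:
  assumes M1: "sigma_finite_measure M1" and M2: "sigma_finite_measure M2" and M3: "sigma_finite_measure M3"
    and Q: "{v \<in> space ((M1 \<Otimes>\<^sub>M M2) \<Otimes>\<^sub>M M3). Q (fst (fst v)) (snd (fst v)) (snd v)} \<in> sets ((M1 \<Otimes>\<^sub>M M2) \<Otimes>\<^sub>M M3)"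
    and AE: "AE x in M1. AE y in M2. AE z in M3. Q x y z"
  shows "AE z in M3. AE x in M1. AE y in M2. Q x y z"
proof -
  interpret M12: pair_sigma_finite M1 M2
    by (intro pair_sigma_finite.intro M1 M2)
  interpret M3: sigma_finite_measure M3 by fact
  interpret M123: pair_sigma_finite "M1 \<Otimes>\<^sub>M M2" M3 ..
  let ?M = "(M1 \<Otimes>\<^sub>M M2) \<Otimes>\<^sub>M M3"
  define N where "N = space ?M - {v \<in> space ?M. Q (fst (fst v)) (snd (fst v)) (snd v)}"
  have N [measurable]: "N \<in> sets ?M" unfolding N_def using Q by (rule sets.compl_sets)
  have [measurable]: "(\<lambda>w. emeasure M3 (Pair w -` N)) \<in> borel_measurable (M1 \<Otimes>\<^sub>M M2)"
    by (rule M3.measurable_emeasure_Pair[OF N])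
  have AE_iff: "(AE z in M3. Q (fst w) (snd w) z) \<longleftrightarrow> emeasure M3 (Pair w -` N) = 0"
    if w: "w \<in> space (M1 \<Otimes>\<^sub>M M2)" for w
  proof (rule AE_iff_measurable[OF sets_Pair1[OF N]])
    show "{z \<in> space M3. \<not> Q (fst w) (snd w) z} = Pair w -` N"
      using w by (auto simp: N_def space_pair_measure)
  qed
  have "AE w in M1 \<Otimes>\<^sub>M M2. AE z in M3. Q (fst w) (snd w) z"
  proof (rule M12.AE_pair_measure)
    have "{w \<in> space (M1 \<Otimes>\<^sub>M M2). emeasure M3 (Pair w -` N) = 0} \<in> sets (M1 \<Otimes>\<^sub>M M2)"
      by measurable
    also have "{w \<in> space (M1 \<Otimes>\<^sub>M M2). emeasure M3 (Pair w -` N) = 0}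
        = {w \<in> space (M1 \<Otimes>\<^sub>M M2). AE z in M3. Q (fst w) (snd w) z}"
      using AE_iff by auto
    finally show "{w \<in> space (M1 \<Otimes>\<^sub>M M2). AE z in M3. Q (fst w) (snd w) z} \<in> sets (M1 \<Otimes>\<^sub>M M2)" .
  qed (use AE in simp)
  then have "AE z in M3. AE w in M1 \<Otimes>\<^sub>M M2. Q (fst w) (snd w) z"
    using M123.AE_commute[of "\<lambda>w z. Q (fst w) (snd w) z"] Q by simp
  then show ?thesis
  proof eventually_elim
    case (elim z)
    from M12.AE_pair[OF elim] show ?case by simp
  qed
qed

text \<open>One good y suffices: y + t runs over the whole line, so almost every point lies in Y or
  not as y does.\<close>

lemma AE_lborel_const_of_translation_invariant:
  fixes Y :: "real set"
  assumes "AE y in lborel. AE t in lborel. y + t \<in> Y \<longleftrightarrow> y \<in> Y"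
  shows "(AE y in lborel. y \<notin> Y) \<or> (AE y in lborel. y \<in> Y)"
proof -
  have "\<exists>y. AE t in lborel. y + t \<in> Y \<longleftrightarrow> y \<in> Y"
    by (rule AE_lborel_ex[OF assms])
  then obtain y where "AE t in lborel. y + t \<in> Y \<longleftrightarrow> y \<in> Y" by blast
  from AE_lborel_translate[OF this, of "- y"]
  have "AE t in lborel. t \<in> Y \<longleftrightarrow> y \<in> Y" by simp
  then show ?thesis by (cases "y \<in> Y") simp_all
qed

text \<open>The set \<open>B\<close> is pulled back to \<open>\<real> \<times> \<real>\<^sup>d\<close> along an equivariant projection onto \<open>H\<close>.\<close>

lemma AE_sections_trivial:
  fixes \<beta> :: "real ^ 'd" and \<eta> :: "(real ^ 'd) measure"
  assumes \<alpha>: "\<alpha> \<notin> \<rat>" and \<beta>: "\<And>j. 0 \<le> \<beta> $ j \<and> \<beta> $ j < 1"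
    and coh: "cohomologous (rotation \<alpha>) (step_cocycle \<beta>) \<Psi>"
    and H: "closed_subgroup H" and \<eta>: "haar_measure_on H \<eta>" and \<Psi>H: "\<forall>x\<in>{0..<1}. \<Psi> x \<in> H"
    and B: "B \<in> sets ((circle \<Otimes>\<^sub>M \<eta>) \<Otimes>\<^sub>M lborel)"
    and inv: "\<And>x h y. x \<in> {0..<1} \<Longrightarrow> h \<in> H \<Longrightarrow>
      ((rotation \<alpha> x, h + \<Psi> x), y + sawtooth x) \<in> B \<longleftrightarrow> ((x, h), y) \<in> B"
  shows "AE x in circle. AE h in \<eta>.
    (AE y in lborel. ((x, h), y) \<notin> B) \<or> (AE y in lborel. ((x, h), y) \<in> B)"
proof -
  have cl: "closed H" using H by (rule closed_subgroupD)
  interpret \<eta>: sigma_finite_measure \<eta> by (rule haar_sigma_finite[OF cl \<eta>])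
  interpret C: pair_sigma_finite "lborel :: real measure" \<eta> ..
  have W: "pair_sigma_finite (lborel :: real measure) (lborel :: (real ^ 'd) measure)" ..
  interpret P: pair_sigma_finite circle "(lborel :: real measure) \<Otimes>\<^sub>M (lborel :: (real ^ 'd) measure)" ..
  interpret PC: pair_sigma_finite "circle \<Otimes>\<^sub>M ((lborel :: real measure) \<Otimes>\<^sub>M (lborel :: (real ^ 'd) measure))"
    "(lborel :: real measure) \<Otimes>\<^sub>M \<eta>" ..
  let ?L = "lborel :: real measure" and ?Lz = "lborel :: (real ^ 'd) measure"
  note [simp] = haar_space[OF \<eta>]
  note [measurable] = B
  have [measurable]: "(\<lambda>h. h) \<in> borel_measurable \<eta>" by (rule measurable_haar_id[OF \<eta>])
  obtain f where f: "f \<in> borel_measurable circle"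
    and eq: "AE x in circle. step_cocycle \<beta> x - \<Psi> x = f x - f (rotation \<alpha> x)"
    using coh unfolding cohomologous_def by blast
  define g where "g x = f (frac x)" for x
  have g [measurable]: "g \<in> borel_measurable borel"
    unfolding g_def[abs_def] by (rule measurable_compose[OF _ f]) measurable
  obtain p where p_m [measurable]: "p \<in> borel_measurable borel"
    and p_H: "\<And>z. p z \<in> H" and p_add: "\<And>z h. h \<in> H \<Longrightarrow> p (z + h) = p z + h"
    by (rule equivariant_borel_projection[OF H]) blast
  have p_add_H: "p z + h \<in> H" if "h \<in> H" for z h
    using closed_subgroupD(3)[OF H p_H that] .
  \<comment> \<open>The extra h enables the passage from almost every z to almost every point of H:
    Fubini exchanges the two below, and for a single fixed z the points p z + h run through all of
    H.\<close>
  have B_iff: "AE x in circle. AE y in ?L. AE z in ?Lz.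
      ((x, p z + h), y + t) \<in> B \<longleftrightarrow> ((x, p z + h), y) \<in> B" if h: "h \<in> H" for t h
  proof -
    let ?F = "\<lambda>u :: real \<times> real \<times> (real ^ 'd).
      ((frac (fst u), p (snd (snd u) - vec (fst (snd u)) + g (fst u))), fst (snd u))"
    \<comment> \<open>Along the sawtooth skew product, \<open>shear w + g x\<close> changes by
      exactly \<Psi> x, thanks to the cohomology equation, and \<open>fst w\<close> by the sawtooth.
      Equivariance of p turns this into the motion under which B is invariant.\<close>
    define A where "A = ?F -` B \<inter> space (borel \<Otimes>\<^sub>M (borel \<Otimes>\<^sub>M borel))"
    have "(\<lambda>u. p (snd (snd u) - vec (fst (snd u)) + g (fst u))) \<in> measurable (borel \<Otimes>\<^sub>M (borel \<Otimes>\<^sub>M borel)) \<eta>"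
      by (rule measurable_into_haar[OF \<eta> _ p_H]) measurable
    then have "?F \<in> measurable (borel \<Otimes>\<^sub>M (borel \<Otimes>\<^sub>M borel)) ((circle \<Otimes>\<^sub>M \<eta>) \<Otimes>\<^sub>M lborel)"
      by measurable
    then have "A \<in> sets (borel \<Otimes>\<^sub>M (borel \<Otimes>\<^sub>M borel))"
      unfolding A_def by (rule measurable_sets[OF _ B])
    then have A: "A \<in> sets (borel \<Otimes>\<^sub>M borel)" by (simp only: borel_prod)
    have A_iff: "(x, w) \<in> A \<longleftrightarrow> ((frac x, p (shear w + g x)), fst w) \<in> B" for x w
      by (simp add: A_def space_pair_measure shear_def)
    have "AE x in circle. \<forall>w. (rotation \<alpha> x, w + sawtooth_cocycle \<beta> x) \<in> A \<longleftrightarrow> (x, w) \<in> A"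
      using eq AE_space
    proof eventually_elim
      case (elim x)
      have x: "x \<in> {0..<1}" using elim(2) by simp
      have fracs: "frac x = x" "frac (rotation \<alpha> x) = rotation \<alpha> x"
        using x by (simp_all add: frac_eq)
      have sx: "shear (sawtooth_cocycle \<beta> x) = step_cocycle \<beta> x" "fst (sawtooth_cocycle \<beta> x) = sawtooth x"
        using sawtooth_cocycle_eq[of \<beta> x] \<beta> x by (simp_all add: shear_def diag_def)
      show ?case
      proof
        fix w
        have "shear (w + sawtooth_cocycle \<beta> x) + g (rotation \<alpha> x) = (shear w + g x) + \<Psi> x"
          using elim(1) by (simp add: g_def fracs shear_add sx algebra_simps)
        then have "p (shear (w + sawtooth_cocycle \<beta> x) + g (rotation \<alpha> x)) = p (shear w + g x) + \<Psi> x"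
          using p_add \<Psi>H x by simp
        then show "(rotation \<alpha> x, w + sawtooth_cocycle \<beta> x) \<in> A \<longleftrightarrow> (x, w) \<in> A"
          using inv[OF x p_H] by (simp add: A_iff fracs sx)
      qed
    qed
    from AE_invariant_diag[OF \<alpha> A this, of t] AE_space
    show ?thesis
    proof eventually_elim
      case (elim x)
      have x: "frac x = x" using elim(2) by (simp add: frac_eq)
      have "AE w in ?L \<Otimes>\<^sub>M ?Lz. (x, w + diag t) \<in> A \<longleftrightarrow> (x, w) \<in> A"
        unfolding lborel_prod by (rule elim(1))
      from pair_sigma_finite.AE_pair[OF W this] show ?case
      proof eventually_elim
        case (elim y)
        \<comment> \<open>This translation turns the argument of p into z + h, removing y and g x
          from it.\<close>
        from AE_lborel_translate[OF elim, of "vec y - g x + h"] show ?case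
        proof eventually_elim
          case (elim z)
          have "shear (y, z + (vec y - g x + h)) + g x = z + h"
            "shear ((y, z + (vec y - g x + h)) + diag t) + g x = z + h"
            by (simp_all add: shear_def diag_def vec_add algebra_simps)
          then show ?case
            using elim unfolding A_iff x by (simp add: p_add[OF h]) (simp add: diag_def)
        qed
      qed
    qed
  qed
  let ?P = "circle \<Otimes>\<^sub>M (?L \<Otimes>\<^sub>M ?Lz)" and ?C = "?L \<Otimes>\<^sub>M \<eta>"
  let ?R = "\<lambda>u c. ((fst u, p (snd (snd u)) + snd c), fst (snd u) + fst c) \<in> B \<longleftrightarrow>
      ((fst u, p (snd (snd u)) + snd c), fst (snd u)) \<in> B"
  have snd_C [measurable]: "(\<lambda>v. snd (snd v)) \<in> borel_measurable (?P \<Otimes>\<^sub>M ?C)"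
    by (rule measurable_compose[OF _ measurable_haar_id[OF \<eta>]]) measurable
  have p_sum [measurable]: "(\<lambda>v. p (snd (snd (fst v))) + snd (snd v)) \<in> measurable (?P \<Otimes>\<^sub>M ?C) \<eta>"
    by (rule measurable_into_haar[OF \<eta>]) (measurable, auto simp: space_pair_measure p_add_H)
  have R: "{v \<in> space (?P \<Otimes>\<^sub>M ?C). ?R (fst v) (snd v)} \<in> sets (?P \<Otimes>\<^sub>M ?C)"
    by measurable
  have "AE c in ?C. AE u in ?P. ?R u c"
  proof (rule AE_I2)
    fix c assume c: "c \<in> space ?C"
    then have "snd c \<in> H" by (auto simp: space_pair_measure)
    have "(\<lambda>u. (u, c)) -` {v \<in> space (?P \<Otimes>\<^sub>M ?C). ?R (fst v) (snd v)} \<inter> space ?P \<in> sets ?P"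
      by (rule measurable_sets[OF measurable_Pair2'[OF c] R])
    moreover have "(\<lambda>u. (u, c)) -` {v \<in> space (?P \<Otimes>\<^sub>M ?C). ?R (fst v) (snd v)} \<inter> space ?P
        = {u \<in> space ?P. ?R u c}"
      using c by (auto simp: space_pair_measure)
    ultimately have Rc: "{u \<in> space ?P. ?R u c} \<in> sets ?P" by simp
    show "AE u in ?P. ?R u c"
    proof (rule P.AE_pair_measure[OF Rc])
      from B_iff[OF \<open>snd c \<in> H\<close>, of "fst c"] AE_space
      show "AE x in circle. AE w in ?L \<Otimes>\<^sub>M ?Lz. ?R (x, w) c"
      proof eventually_elim
        case (elim x)
        have "Pair x -` {u \<in> space ?P. ?R u c} = {w \<in> space (?L \<Otimes>\<^sub>M ?Lz). ?R (x, w) c}"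
          using elim(2) by (auto simp: space_pair_measure)
        with sets_Pair1[OF Rc, of x]
        have "{w \<in> space (?L \<Otimes>\<^sub>M ?Lz). ?R (x, w) c} \<in> sets (?L \<Otimes>\<^sub>M ?Lz)" by simp
        then show ?case
          by (rule pair_sigma_finite.AE_pair_measure[OF W]) (use elim(1) in simp)
      qed
    qed
  qed
  then have "AE u in ?P. AE c in ?C. ?R u c"
    using PC.AE_commute[OF R] by simp
  from P.AE_pair[OF this] AE_space
  show ?thesis
  proof eventually_elim
    case (elim x)
    have x: "x \<in> space circle" by fact
    from pair_sigma_finite.AE_pair[OF W elim(1)]
    have "AE y in ?L. AE t in ?L. AE h in \<eta>. ((x, h), y + t) \<in> B \<longleftrightarrow> ((x, h), y) \<in> B"
    proof eventually_elim
      case (elim y)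
      then obtain z where z: "AE c in ?C. ?R (x, (y, z)) c"
        using AE_lborel_ex by blast
      from C.AE_pair[OF z] show ?case
      proof eventually_elim
        case (elim t)
        \<comment> \<open>Translating by -p z turns a statement on p z + h for almost every h into
          one on almost every h.\<close>
        from AE_haar_translate[OF H \<eta> closed_subgroupD(4)[OF H p_H[of z]] elim]
        show ?case by eventually_elim simp
      qed
    qed
    moreover have "{v \<in> space ((?L \<Otimes>\<^sub>M ?L) \<Otimes>\<^sub>M \<eta>).
        ((x, snd v), fst (fst v) + snd (fst v)) \<in> B \<longleftrightarrow> ((x, snd v), fst (fst v)) \<in> B} \<in> sets ((?L \<Otimes>\<^sub>M ?L) \<Otimes>\<^sub>M \<eta>)"
    proof -
      have [measurable]: "(\<lambda>v. x) \<in> measurable ((?L \<Otimes>\<^sub>M ?L) \<Otimes>\<^sub>M \<eta>) circle"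
        by (rule measurable_const[OF x])
      show ?thesis by measurable
    qed
    ultimately have "AE h in \<eta>. AE y in ?L. AE t in ?L. ((x, h), y + t) \<in> B \<longleftrightarrow> ((x, h), y) \<in> B"
      by (rule AE_commute3[OF lborel.sigma_finite_measure_axioms lborel.sigma_finite_measure_axioms
            \<eta>.sigma_finite_measure_axioms, rotated])
    then show ?case
    proof eventually_elim
      case (elim h)
      then show ?case
        using AE_lborel_const_of_translation_invariant[of "{y. ((x, h), y) \<in> B}"] by simp
    qed
  qed
qed

section \<open>The extension by the sawtooth in product coordinates\<close>

text \<open>The inverse of w \<mapsto> (shear w, fst w): a quotient coordinate and the parameter
  along the diagonal.\<close>

definition unshear :: "(real ^ 'd) \<times> real \<Rightarrow> real \<times> (real ^ 'd)" where
  "unshear v = (0, fst v) + diag (snd v)"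

lemma shear_unshear [simp]: "shear (unshear v) = fst v"
  by (simp add: unshear_def diag_def shear_def)

lemma fst_unshear [simp]: "fst (unshear v) = snd v"
  by (simp add: unshear_def diag_def)

lemma shear_minus: "shear (- w) = - shear w"
  by (simp add: shear_def vec_neg)

lemma unshear_add: "unshear (h, y) + w = unshear (h + shear w, y + fst w)"
  by (cases w) (simp add: unshear_def diag_def shear_def vec_add)

lemma closed_subgroup_shear_vimage:
  assumes H: "closed_subgroup H"
  shows "closed_subgroup {w. shear w \<in> H}"
  unfolding closed_subgroup_def
proof (intro conjI ballI)
  have "continuous_on UNIV (shear :: _ \<Rightarrow> real ^ 'd)"
    unfolding shear_def[abs_def]
    by (intro continuous_intros continuous_on_compose2[OF continuous_on_vec[of UNIV]]) auto
  then have "closed (shear -` H)" by (intro closed_vimage closed_subgroupD(1)[OF H])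
  then show "closed {w. shear w \<in> H}" by (simp add: vimage_def)
  show "0 \<in> {w. shear w \<in> H}" using closed_subgroupD(2)[OF H] by (simp add: shear_def)
  show "x + y \<in> {w. shear w \<in> H}" if "x \<in> {w. shear w \<in> H}" "y \<in> {w. shear w \<in> H}" for x y
    using that closed_subgroupD(3)[OF H] by (simp add: shear_add)
  show "- x \<in> {w. shear w \<in> H}" if "x \<in> {w. shear w \<in> H}" for x
    using that closed_subgroupD(4)[OF H] by (simp add: shear_minus)
qed

text \<open>In the coordinates of \<open>unshear\<close> the new system extends the given skew
  product over H by the sawtooth on H x R, with \<eta> times Lebesgue measure.
  \<open>AE_sections_trivial\<close> makes almost every line section of an invariant set null or
  conull, so such a set is determined by a subset of the base, where ergodicity is given.\<close>

theorem regular_sawtooth_cocycle: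
  fixes \<beta> :: "real ^ 'd"
  assumes \<alpha>: "\<alpha> \<notin> \<rat>" and \<beta>: "\<And>j. 0 \<le> \<beta> $ j \<and> \<beta> $ j < 1"
    and reg: "regular_cocycle (rotation \<alpha>) (step_cocycle \<beta>)"
  shows "regular_cocycle (rotation \<alpha>) (sawtooth_cocycle \<beta>)"
proof -
  obtain \<Psi> H \<eta> where \<Psi>: "cocycle \<Psi>" and coh: "cohomologous (rotation \<alpha>) (step_cocycle \<beta>) \<Psi>"
    and H: "closed_subgroup H" and \<Psi>H: "\<forall>x\<in>{0..<1}. \<Psi> x \<in> H" and \<eta>: "haar_measure_on H \<eta>"
    and erg: "ergodic (circle \<Otimes>\<^sub>M \<eta>) (skew_product (rotation \<alpha>) \<Psi>)"
    using reg unfolding regular_cocycle_def by blast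
  have cl: "closed H" using H by (rule closed_subgroupD)
  interpret \<eta>: sigma_finite_measure \<eta> by (rule haar_sigma_finite[OF cl \<eta>])
  interpret V: pair_sigma_finite circle \<eta> ..
  note [simp] = haar_space[OF \<eta>]
  let ?L = "lborel :: real measure"
  define H' where "H' = {w. shear w \<in> H}"
  have H': "closed_subgroup H'" unfolding H'_def by (rule closed_subgroup_shear_vimage[OF H])
  have cl': "closed H'" using H' by (rule closed_subgroupD)
  define \<Psi>' where "\<Psi>' x = unshear (\<Psi> x, sawtooth x)" for x
  have un_m: "unshear \<in> borel_measurable (borel \<Otimes>\<^sub>M borel)"
    unfolding unshear_def[abs_def] diag_def by measurable
  have un_H': "unshear (h, y) \<in> H'" if "h \<in> H" for h y
    using that by (simp add: H'_def)
  have \<Psi>': "cocycle \<Psi>'"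
    unfolding cocycle_def \<Psi>'_def[abs_def]
    by (rule measurable_compose[OF measurable_Pair[OF \<Psi>[unfolded cocycle_def]] un_m])
      (rule measurable_circle_restrict, measurable)
  have \<Psi>'H': "\<forall>x\<in>{0..<1}. \<Psi>' x \<in> H'" using \<Psi>H un_H' by (simp add: \<Psi>'_def)
  have coh': "cohomologous (rotation \<alpha>) (sawtooth_cocycle \<beta>) \<Psi>'"
  proof -
    obtain f where f: "f \<in> borel_measurable circle"
      and eq: "AE x in circle. step_cocycle \<beta> x - \<Psi> x = f x - f (rotation \<alpha> x)"
      using coh unfolding cohomologous_def by blast
    \<comment> \<open>The sawtooth coordinate is kept as it is, so the transfer function has first
      coordinate 0.\<close>
    have "AE x in circle. sawtooth_cocycle \<beta> x - \<Psi>' x = (0::real, f x) - (0::real, f (rotation \<alpha> x))"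
      using eq AE_space
    proof eventually_elim
      case (elim x)
      have "sawtooth_cocycle \<beta> x = (0, step_cocycle \<beta> x) + diag (sawtooth x)"
        using elim(2) \<beta> by (intro sawtooth_cocycle_eq) auto
      then show ?case using elim(1) by (simp add: \<Psi>'_def unshear_def)
    qed
    moreover have "(\<lambda>x. (0::real, f x)) \<in> borel_measurable circle"
      using f by (intro borel_measurable_Pair) auto
    ultimately show ?thesis
      unfolding cohomologous_def by (intro bexI[of _ "\<lambda>x. (0::real, f x)"])
  qed
  define \<eta>' where "\<eta>' = distr (\<eta> \<Otimes>\<^sub>M ?L) (restrict_space borel H') unshear"
  have sets': "sets \<eta>' = sets (restrict_space borel H')" by (simp add: \<eta>'_def)
  have un_b: "unshear \<in> borel_measurable (\<eta> \<Otimes>\<^sub>M ?L)"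
  proof -
    have "(\<lambda>v. (fst v, snd v)) \<in> measurable (\<eta> \<Otimes>\<^sub>M ?L) (borel \<Otimes>\<^sub>M borel)"
      by (intro measurable_Pair measurable_compose[OF measurable_fst measurable_haar_id[OF \<eta>]]) measurable
    from measurable_compose[OF this un_m] show ?thesis by simp
  qed
  have un: "unshear \<in> measurable (\<eta> \<Otimes>\<^sub>M ?L) (restrict_space borel H')"
    by (rule measurable_restrict_space2[OF _ un_b]) (auto simp: space_pair_measure un_H')
  have em': "emeasure \<eta>' C = (\<integral>\<^sup>+h. emeasure ?L {y. unshear (h, y) \<in> C} \<partial>\<eta>)"
    and em'_m: "(\<lambda>h. emeasure ?L {y. unshear (h, y) \<in> C}) \<in> borel_measurable \<eta>"
    if C: "C \<in> sets \<eta>'" for C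
  proof -
    have C': "C \<in> sets (restrict_space borel H')" using C sets' by simp
    let ?D = "unshear -` C \<inter> space (\<eta> \<Otimes>\<^sub>M ?L)"
    have D: "?D \<in> sets (\<eta> \<Otimes>\<^sub>M ?L)" by (rule measurable_sets[OF un C'])
    have sec: "Pair h -` ?D = {y. unshear (h, y) \<in> C}" if "h \<in> space \<eta>" for h
      using that by (auto simp: space_pair_measure)
    have "emeasure \<eta>' C = emeasure (\<eta> \<Otimes>\<^sub>M ?L) ?D"
      unfolding \<eta>'_def by (rule emeasure_distr[OF un C'])
    also have "\<dots> = (\<integral>\<^sup>+h. emeasure ?L (Pair h -` ?D) \<partial>\<eta>)"
      by (rule lborel.emeasure_pair_measure_alt[OF D])
    also have "\<dots> = (\<integral>\<^sup>+h. emeasure ?L {y. unshear (h, y) \<in> C} \<partial>\<eta>)"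
      by (rule nn_integral_cong) (simp only: sec)
    finally show "emeasure \<eta>' C = (\<integral>\<^sup>+h. emeasure ?L {y. unshear (h, y) \<in> C} \<partial>\<eta>)" .
    show "(\<lambda>h. emeasure ?L {y. unshear (h, y) \<in> C}) \<in> borel_measurable \<eta>"
      using lborel.measurable_emeasure_Pair[OF D]
      by (rule measurable_cong[THEN iffD1, rotated]) (simp only: sec)
  qed
  have \<eta>': "haar_measure_on H' \<eta>'"
  proof (rule haar_measure_onI[OF H' sets'])
    have "H' \<in> sets \<eta>'"
      unfolding sets' using cl' by (simp add: sets_restrict_space_iff)
    then have "emeasure \<eta>' H' = (\<integral>\<^sup>+h. emeasure ?L {y. unshear (h, y) \<in> H'} \<partial>\<eta>)"
      by (rule em')
    also have "\<dots> = (\<integral>\<^sup>+h. \<infinity> \<partial>\<eta>)"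
      by (rule nn_integral_cong) (simp add: un_H')
    also have "\<dots> = \<infinity> * emeasure \<eta> H" by simp
    finally show "emeasure \<eta>' H' \<noteq> 0" using \<eta> by (simp add: haar_measure_on_def)
  next
    fix K assume K: "compact K" "K \<subseteq> H'"
    have "compact (fst ` K)"
      by (intro compact_continuous_image continuous_intros K)
    then have f1: "emeasure ?L (fst ` K) < \<infinity>" and f2: "fst ` K \<in> sets ?L"
      using emeasure_compact_finite by (auto intro: borel_closed compact_imp_closed)
    have "compact (shear ` K)"
      unfolding shear_def[abs_def]
      by (intro compact_continuous_image continuous_intros continuous_on_compose2[OF continuous_on_vec[of UNIV]] K) auto
    moreover have "shear ` K \<subseteq> H" using K by (auto simp: H'_def)
    ultimately have s1: "emeasure \<eta> (shear ` K) < \<infinity>" and s2: "shear ` K \<in> sets \<eta>"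
      using \<eta> haar_sets_iff[OF cl \<eta>] by (auto simp: haar_measure_on_def intro: borel_closed compact_imp_closed)
    have "K \<in> sets \<eta>'"
      unfolding sets' using K cl' by (auto simp: sets_restrict_space_iff intro: borel_closed compact_imp_closed)
    then have "emeasure \<eta>' K = (\<integral>\<^sup>+h. emeasure ?L {y. unshear (h, y) \<in> K} \<partial>\<eta>)"
      by (rule em')
    \<comment> \<open>K lies in the box spanned by its compact projections under
      \<open>shear\<close> and \<open>fst\<close>.\<close>
    also have "\<dots> \<le> (\<integral>\<^sup>+h. emeasure ?L (fst ` K) * indicator (shear ` K) h \<partial>\<eta>)"
    proof (rule nn_integral_mono)
      fix h
      have sub: "{y. unshear (h, y) \<in> K} \<subseteq> fst ` K"
        by (auto intro!: image_eqI[of _ fst "unshear (h, _)"])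
      show "emeasure ?L {y. unshear (h, y) \<in> K} \<le> emeasure ?L (fst ` K) * indicator (shear ` K) h"
      proof (cases "h \<in> shear ` K")
        case True
        then show ?thesis using emeasure_mono[OF sub f2] by simp
      next
        case False
        then have "{y. unshear (h, y) \<in> K} = {}" by (force simp: image_iff)
        then show ?thesis by simp
      qed
    qed
    also have "\<dots> = emeasure ?L (fst ` K) * emeasure \<eta> (shear ` K)"
      by (rule nn_integral_cmult_indicator[OF s2])
    also have "\<dots> < \<infinity>" using f1 s1 by (simp add: ennreal_mult_less_top)
    finally show "emeasure \<eta>' K < \<infinity>" .
  next
    fix w C assume w: "w \<in> H'" and C: "C \<in> sets \<eta>'"
    have k: "shear w \<in> H" using w by (simp add: H'_def)
    have C': "C \<in> sets borel" "C \<subseteq> H'"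
      using C unfolding sets' using cl' by (auto simp: sets_restrict_space_iff)
    have "{x \<in> H'. x + w \<in> C} = (\<lambda>x. x + w) -` C \<inter> H'" by auto
    moreover have "(\<lambda>x. x + w) -` C \<in> sets borel"
      using measurable_sets_borel[of "\<lambda>x. x + w" borel C] C'(1) by simp
    ultimately have "{x \<in> H'. x + w \<in> C} \<in> sets \<eta>'"
      unfolding sets' using cl' by (auto simp: sets_restrict_space_iff)
    then have "emeasure \<eta>' {x \<in> H'. x + w \<in> C}
        = (\<integral>\<^sup>+h. emeasure ?L {y. unshear (h, y) \<in> {x \<in> H'. x + w \<in> C}} \<partial>\<eta>)"
      by (rule em')
    also have "\<dots> = (\<integral>\<^sup>+h. emeasure ?L {y. unshear (h + shear w, y) \<in> C} \<partial>\<eta>)"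
    proof (rule nn_integral_cong)
      fix h assume h: "h \<in> space \<eta>"
      have "unshear -` C \<inter> space (borel \<Otimes>\<^sub>M borel) \<in> sets (borel \<Otimes>\<^sub>M borel)"
        by (rule measurable_sets[OF un_m C'(1)])
      from sets_Pair1[OF this, of "h + shear w"]
      have "{y. unshear (h + shear w, y) \<in> C} \<in> sets borel"
        by (simp add: space_pair_measure vimage_def)
      from emeasure_vimage_translation[OF this, of "fst w"]
      show "emeasure ?L {y. unshear (h, y) \<in> {x \<in> H'. x + w \<in> C}} = emeasure ?L {y. unshear (h + shear w, y) \<in> C}"
        using h by (simp add: unshear_add un_H')
    qed
    also have "\<dots> = (\<integral>\<^sup>+h. emeasure ?L {y. unshear (h, y) \<in> C} \<partial>distr \<eta> \<eta> (\<lambda>h. h + shear w))"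
      by (rule nn_integral_distr[symmetric, OF distr_haar_translation(1)[OF H \<eta> k]])
        (simp add: em'_m[OF C])
    also have "\<dots> = emeasure \<eta>' C"
      unfolding distr_haar_translation(2)[OF H \<eta> k] by (rule em'[OF C, symmetric])
    finally show "emeasure \<eta>' {x \<in> H'. x + w \<in> C} = emeasure \<eta>' C" .
  qed
  interpret \<eta>': sigma_finite_measure \<eta>' by (rule haar_sigma_finite[OF cl' \<eta>'])
  note [simp] = haar_space[OF \<eta>']
  let ?V = "circle \<Otimes>\<^sub>M \<eta>" and ?M = "circle \<Otimes>\<^sub>M \<eta>'"
  let ?T = "skew_product (rotation \<alpha>) \<Psi>" and ?S = "skew_product (rotation \<alpha>) \<Psi>'"
  let ?F = "\<lambda>u :: (real \<times> (real ^ 'd)) \<times> real. (fst (fst u), unshear (snd (fst u), snd u))"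
  \<comment> \<open>The base point v = (x, h) belongs to the given skew product; the section runs
    along the diagonal.\<close>
  define Y where "Y A v = {y. (fst v, unshear (snd v, y)) \<in> A}"
    for A :: "(real \<times> (real \<times> (real ^ 'd))) set" and v
  have F: "?F \<in> measurable (?V \<Otimes>\<^sub>M ?L) ?M"
  proof (rule measurable_Pair)
    have un': "unshear \<in> measurable (\<eta> \<Otimes>\<^sub>M ?L) \<eta>'" using un measurable_cong_sets[OF refl sets'] by blast
    have "(\<lambda>u. (snd (fst u), snd u)) \<in> measurable (?V \<Otimes>\<^sub>M ?L) (\<eta> \<Otimes>\<^sub>M ?L)" by measurable
    from measurable_compose[OF this un'] show "(\<lambda>u. unshear (snd (fst u), snd u)) \<in> measurable (?V \<Otimes>\<^sub>M ?L) \<eta>'" .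
  qed (rule measurable_compose[OF measurable_fst measurable_fst])
  have sec: "Pair v -` (?F -` A \<inter> space (?V \<Otimes>\<^sub>M ?L)) = Y A v" if "v \<in> space ?V" for A v
    using that by (auto simp: space_pair_measure Y_def)
  have Y_m: "(\<lambda>v. emeasure ?L (Y A v)) \<in> borel_measurable ?V" if A: "A \<in> sets ?M" for A
    using lborel.measurable_emeasure_Pair[OF measurable_sets[OF F A]]
    by (rule measurable_cong[THEN iffD1, rotated]) (simp only: sec)
  have Y_sets: "Y A v \<in> sets ?L" if "A \<in> sets ?M" "v \<in> space ?V" for A v
    using sets_Pair1[OF measurable_sets[OF F that(1)], of v] sec[OF that(2)] by simp
  have em: "emeasure ?M A = (\<integral>\<^sup>+v. emeasure ?L (Y A v) \<partial>?V)" if A: "A \<in> sets ?M" for A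
  proof -
    have "emeasure ?M A = (\<integral>\<^sup>+x. emeasure \<eta>' (Pair x -` A) \<partial>circle)"
      by (rule \<eta>'.emeasure_pair_measure_alt[OF A])
    also have "\<dots> = (\<integral>\<^sup>+x. \<integral>\<^sup>+h. emeasure ?L (Y A (x, h)) \<partial>\<eta> \<partial>circle)"
      by (rule nn_integral_cong) (simp add: em'[OF sets_Pair1[OF A]] Y_def)
    also have "\<dots> = (\<integral>\<^sup>+v. emeasure ?L (Y A v) \<partial>?V)"
      using \<eta>.nn_integral_fst[OF Y_m[OF A]] by simp
    finally show ?thesis .
  qed
  have null: "emeasure ?M A = 0" if A: "A \<in> sets ?M" and "AE v in ?V. emeasure ?L (Y A v) = 0" for A
    using that(2) nn_integral_0_iff_AE[OF Y_m[OF A]] em[OF A] by simp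
  have "ergodic ?M ?S"
    unfolding ergodic_def
  proof (intro conjI ballI impI)
    show "?S \<in> measurable ?M ?M" by (rule skew_product_measurable[OF H' \<eta>' \<Psi>' \<Psi>'H'])
    show "distr ?M ?M ?S = ?M" by (rule distr_skew_product[OF H' \<eta>' \<Psi>' \<Psi>'H'])
    fix A assume A: "A \<in> sets ?M" and inv: "?S -` A \<inter> space ?M = A"
    have cA: "space ?M - A \<in> sets ?M" using A by (rule sets.compl_sets)
    let ?B = "?F -` A \<inter> space (?V \<Otimes>\<^sub>M ?L)"
    have B: "?B \<in> sets (?V \<Otimes>\<^sub>M ?L)" by (rule measurable_sets[OF F A])
    have A_inv: "(rotation \<alpha> x, unshear (h + \<Psi> x, y + sawtooth x)) \<in> A \<longleftrightarrow> (x, unshear (h, y)) \<in> A"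
      if "x \<in> {0..<1}" "h \<in> H" for x h y
    proof -
      have "(x, unshear (h, y)) \<in> space ?M" using that un_H' by (simp add: space_pair_measure)
      then have "(x, unshear (h, y)) \<in> A \<longleftrightarrow> ?S (x, unshear (h, y)) \<in> A" using inv by blast
      also have "?S (x, unshear (h, y)) = (rotation \<alpha> x, unshear (h + \<Psi> x, y + sawtooth x))"
        by (simp add: skew_product_def \<Psi>'_def unshear_add)
      finally show ?thesis by simp
    qed
    have cY: "Y (space ?M - A) v = - Y A v" if "v \<in> space ?V" for v
      using that un_H' by (auto simp: Y_def space_pair_measure)
    have triv: "AE v in ?V. emeasure ?L (Y A v) = 0 \<or> emeasure ?L (- Y A v) = 0"
    proof (rule V.AE_pair_measure)
      have [measurable]: "(\<lambda>v. emeasure ?L (Y A v)) \<in> borel_measurable ?V"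
        "(\<lambda>v. emeasure ?L (Y (space ?M - A) v)) \<in> borel_measurable ?V"
        using Y_m A cA by auto
      have "{v \<in> space ?V. emeasure ?L (Y A v) = 0 \<or> emeasure ?L (Y (space ?M - A) v) = 0} \<in> sets ?V"
        by measurable
      also have "{v \<in> space ?V. emeasure ?L (Y A v) = 0 \<or> emeasure ?L (Y (space ?M - A) v) = 0}
          = {v \<in> space ?V. emeasure ?L (Y A v) = 0 \<or> emeasure ?L (- Y A v) = 0}"
        using cY by auto
      finally show "{v \<in> space ?V. emeasure ?L (Y A v) = 0 \<or> emeasure ?L (- Y A v) = 0} \<in> sets ?V" .
      have "AE x in circle. AE h in \<eta>. (AE y in ?L. ((x, h), y) \<notin> ?B) \<or> (AE y in ?L. ((x, h), y) \<in> ?B)"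
      proof (rule AE_sections_trivial[OF \<alpha> \<beta> coh H \<eta> \<Psi>H B])
        fix x y :: real and h assume "x \<in> {0..<1}" "h \<in> H"
        then show "((rotation \<alpha> x, h + \<Psi> x), y + sawtooth x) \<in> ?B \<longleftrightarrow> ((x, h), y) \<in> ?B"
          using A_inv closed_subgroupD(3)[OF H] \<Psi>H by (simp add: space_pair_measure)
      qed
      with AE_space
      show "AE x in circle. AE h in \<eta>. emeasure ?L (Y A (x, h)) = 0 \<or> emeasure ?L (- Y A (x, h)) = 0"
      proof eventually_elim
        case (elim x)
        from elim(2) AE_space
        show ?case
        proof eventually_elim
          case (elim h)
          have v: "(x, h) \<in> space ?V" using elim(2) \<open>x \<in> space circle\<close> by (simp add: space_pair_measure)
          have "((x, h), y) \<in> ?B \<longleftrightarrow> y \<in> Y A (x, h)" for y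
            using v by (simp add: Y_def space_pair_measure)
          then have "(AE y in ?L. y \<notin> Y A (x, h)) \<or> (AE y in ?L. y \<notin> - Y A (x, h))"
            using elim(1) by simp
          moreover have "Y A (x, h) \<in> sets ?L" by (rule Y_sets[OF A v])
          moreover from this have "- Y A (x, h) \<in> sets ?L" by auto
          ultimately show ?case
            using AE_iff_null_sets[of "Y A (x, h)" ?L] AE_iff_null_sets[of "- Y A (x, h)" ?L]
            by (metis null_setsD1)
        qed
      qed
    qed
    \<comment> \<open>The base points with conull section. This set is exactly invariant, as
      \<open>ergodic\<close> demands: the sections over v and over its image differ by a translation
      by the sawtooth value, which preserves their measure.\<close>
    define B where "B = {v \<in> space ?V. emeasure ?L (Y (space ?M - A) v) = 0}"
    have B: "B \<in> sets ?V"
    proof -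
      have [measurable]: "(\<lambda>v. emeasure ?L (Y (space ?M - A) v)) \<in> borel_measurable ?V"
        by (rule Y_m[OF cA])
      show ?thesis unfolding B_def by measurable
    qed
    have "?T -` B \<inter> space ?V = B"
    proof (rule set_eqI)
      fix v
      show "v \<in> ?T -` B \<inter> space ?V \<longleftrightarrow> v \<in> B"
      proof (cases "v \<in> space ?V")
        case True
        then obtain x h where v: "v = (x, h)" "x \<in> {0..<1}" "h \<in> H" by (auto simp: space_pair_measure)
        have Tv: "?T v = (rotation \<alpha> x, h + \<Psi> x)" by (simp add: v skew_product_def)
        have Tv_space: "?T v \<in> space ?V"
          unfolding Tv using v \<Psi>H closed_subgroupD(3)[OF H] by (simp add: space_pair_measure)
        have "Y (space ?M - A) v = {y. y + sawtooth x \<in> Y (space ?M - A) (?T v)}"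
          unfolding cY[OF True] cY[OF Tv_space] unfolding Tv
          using A_inv[OF v(2,3)] by (auto simp: Y_def v(1))
        then have "emeasure ?L (Y (space ?M - A) v) = emeasure ?L (Y (space ?M - A) (?T v))"
          using emeasure_vimage_translation[of "Y (space ?M - A) (?T v)" "sawtooth x"]
            Y_sets[OF cA Tv_space] by simp
        then show ?thesis using True Tv_space by (simp add: B_def)
      qed (simp add: B_def)
    qed
    then have "emeasure ?V B = 0 \<or> emeasure ?V (space ?V - B) = 0"
      using erg B unfolding ergodic_def by blast
    then show "emeasure ?M A = 0 \<or> emeasure ?M (space ?M - A) = 0"
    proof
      assume "emeasure ?V B = 0"
      then have "AE v in ?V. v \<notin> B" using B by (subst AE_iff_null_sets[symmetric]) auto
      with triv AE_space have "AE v in ?V. emeasure ?L (Y A v) = 0"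
        by eventually_elim (auto simp: B_def cY)
      then show ?thesis using null[OF A] by simp
    next
      assume "emeasure ?V (space ?V - B) = 0"
      then have "AE v in ?V. v \<notin> space ?V - B" using B by (subst AE_iff_null_sets[symmetric]) auto
      with AE_space have "AE v in ?V. emeasure ?L (Y (space ?M - A) v) = 0"
        by eventually_elim (auto simp: B_def)
      then show ?thesis using null[OF cA] by simp
    qed
  qed
  moreover have "cocycle (sawtooth_cocycle \<beta>)"
    unfolding cocycle_def by (rule measurable_circle_restrict) measurable
  ultimately show ?thesis
    unfolding regular_cocycle_def using \<Psi>' coh' H' \<Psi>'H' \<eta>' by blast
qed

theorem mainTheorem3:
  fixes \<alpha> :: real and \<beta> :: "real ^ 'd"
  assumes "0 < \<alpha>" and "\<alpha> < 1" and "\<alpha> \<notin> \<rat>"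
    and "\<And>j. 0 \<le> \<beta> $ j \<and> \<beta> $ j < 1"
  shows "regular_cocycle (rotation \<alpha>) (sawtooth_cocycle \<beta>) \<longleftrightarrow>
         regular_cocycle (rotation \<alpha>) (step_cocycle \<beta>)"
  using regular_step_cocycle[OF assms(3,4)] regular_sawtooth_cocycle[OF assms(3,4)] by blast

end
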